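(* Let $n\ge 2$. Let $\gamma_0:\mathbb{R}\to\mathbb{R}^n$ be a smooth curve parametrized by its arc-length, $g^0(x)=(e_1^0(x),\ldots,e_n^0(x))$ a parallel frame along $\gamma_0$, and $k_1^0,\ldots,k_{n-1}^0$ the corresponding principal curvatures; put $k^0=(k_1^0,\ldots,k_{n-1}^0)^t$. Let $k=(k_1,\ldots,k_{n-1})^t:\mathbb{R}^2\to\mathbb{R}^{n-1}$ be the (smooth) solution of the Cauchy problem $$k_t=-\left(k_{xxx}+\tfrac32\|k\|^2k_x\right),\qquad k(x,0)=k^0(x).$$ Then there exists a unique $g=(e_1,\ldots,e_n):\mathbb{R}^2\to SO(n)$ satisfying $$g^{-1}g_x=\begin{pmatrix}0&-k^t\\ k&0\end{pmatrix},\qquad g^{-1}g_t=\begin{pmatrix}0&-z^t\\ z&\xi\end{pmatrix},$$ where $z=-(k_{xx}+\frac12\|k\|^2k)$ and $\xi=(\xi_{ij})$ with $\xi_{ij}=(k_i)_xk_j-k_i(k_j)_x$ for $1\le i,j\le n-1$, and satisfying $g(0,0)=g^0(0)$. Moreover, let $$Z=-\left(\frac{\|k\|^2}{2}e_1+\sum_{i=1}^{n-1}(k_i)_xe_{i+1}\right),\qquad c(t)=\int_0^tZ(0,t_1)\,dt_1.$$ Then $$\gamma(x,t)=\gamma_0(0)+c(t)+\int_0^xe_1(s,t)\,ds$$ is the solution of the geometric Airy curve flow $$\gamma_t=-\left(\tfrac12\|H\|^2e_1+\nabla^\perp_{e_1}H(\gamma(\cdot,t))\right)$$ with $\gamma(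x,0)=\gamma_0(x)$.
   Context: For a smooth curve $\gamma:\mathbb{R}\to\mathbb{R}^n$ parametrized by arc-length $x$, a parallel frame along $\gamma$ is a smooth map $g=(e_1,\ldots,e_n):\mathbb{R}\to SO(n)$ (columns $e_i$) with $e_1=\gamma_x$ and $e_2,\ldots,e_n$ parallel with respect to the induced normal connection $\nabla^\perp$; equivalently $(e_1)_x=\sum_{i=1}^{n-1}k_ie_{i+1}$ and $(e_{i+1})_x=-k_ie_1$ for $1\le i\le n-1$, i.e. $g^{-1}g_x=\begin{pmatrix}0&-k^t\\ k&0\end{pmatrix}$ with $k=(k_1,\ldots,k_{n-1})^t$. The function $k_i$ is called the principal curvature of $\gamma$ with respect to $e_{i+1}$. In the flow equation, $e_1=\gamma_x/\|\gamma_x\|$ and $H(\gamma(\cdot,t))$ is the mean curvature (curvature) vector field of the curve $\gamma(\cdot,t)$; in terms of a parallel frame, $H=\sum_ik_ie_{i+1}$ and $\nabla^\perp_{e_1}H=\sum_i(k_i)_xe_{i+1}$. *)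

theory Defs
  imports "HOL-Analysis.Analysis"
begin

text \<open>
  The dimension is \<open>n = CARD('m) + 1 \<ge> 2\<close>. Vectors in \<open>\<real>\<^sup>n\<^sup>-\<^sup>1\<close> are indexed by the finite
  type \<open>'m\<close>, vectors in \<open>\<real>\<^sup>n\<close> by \<open>'m option\<close>: \<open>None\<close> stands for the index \<open>1\<close>
  and \<open>Some i\<close> for the index \<open>i + 1\<close>. As usual \<open>A $ i $ j\<close> is the entry in row \<open>i\<close>, column \<open>j\<close>.
  Functions of \<open>(x, t) \<in> \<real>\<^sup>2\<close> are curried.
\<close>

subsection \<open>Smoothness and partial derivatives\<close>

text \<open>
  On a finite-dimensional domain this is the usual class \<open>C\<^sup>k\<close>: the function is differentiable
  and all its directional derivatives are of class \<open>C\<^sup>k\<^sup>-\<^sup>1\<close>.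
\<close>
primrec C_class :: "nat \<Rightarrow> ('a::real_normed_vector \<Rightarrow> 'b::real_normed_vector) \<Rightarrow> bool" where
  "C_class 0 f \<longleftrightarrow> continuous_on UNIV f"
| "C_class (Suc k) f \<longleftrightarrow> (\<forall>p. f differentiable (at p)) \<and>
     (\<forall>v. C_class k (\<lambda>p. frechet_derivative f (at p) v))"

definition smooth :: "('a::real_normed_vector \<Rightarrow> 'b::real_normed_vector) \<Rightarrow> bool" where
  "smooth f \<longleftrightarrow> (\<forall>k. C_class k f)"

definition smooth2 :: "(real \<Rightarrow> real \<Rightarrow> 'b::real_normed_vector) \<Rightarrow> bool" where
  "smooth2 f \<longleftrightarrow> smooth (\<lambda>(x, t). f x t)"

definition partial_x :: "(real \<Rightarrow> real \<Rightarrow> 'b::real_normed_vector) \<Rightarrow> real \<Rightarrow> real \<Rightarrow> 'b" where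
  "partial_x f x t = vector_derivative (\<lambda>s. f s t) (at x)"

definition partial_t :: "(real \<Rightarrow> real \<Rightarrow> 'b::real_normed_vector) \<Rightarrow> real \<Rightarrow> real \<Rightarrow> 'b" where
  "partial_t f x t = vector_derivative (\<lambda>r. f x r) (at t)"

subsection \<open>Geometry of regular curves\<close>

definition unit_tangent :: "(real \<Rightarrow> 'a::real_inner) \<Rightarrow> real \<Rightarrow> 'a" where
  "unit_tangent c x = vector_derivative c (at x) /\<^sub>R norm (vector_derivative c (at x))"

text \<open>The derivative along \<open>c\<close> of a vector field \<open>V\<close> in the direction of the unit tangent.\<close>
definition arc_derivative :: "(real \<Rightarrow> 'a::real_inner) \<Rightarrow> (real \<Rightarrow> 'a) \<Rightarrow> real \<Rightarrow> 'a" where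
  "arc_derivative c V x = vector_derivative V (at x) /\<^sub>R norm (vector_derivative c (at x))"

text \<open>
  The induced connection on the normal bundle, \<open>\<nabla>\<^sup>\<bottom>\<close> in the direction of the unit tangent, applied
  to a normal field \<open>V\<close>: the normal component of the derivative of \<open>V\<close>.
\<close>
definition normal_connection :: "(real \<Rightarrow> 'a::real_inner) \<Rightarrow> (real \<Rightarrow> 'a) \<Rightarrow> real \<Rightarrow> 'a" where
  "normal_connection c V x =
     arc_derivative c V x - (arc_derivative c V x \<bullet> unit_tangent c x) *\<^sub>R unit_tangent c x"

definition curvature_vector :: "(real \<Rightarrow> 'a::real_inner) \<Rightarrow> real \<Rightarrow> 'a" where
  "curvature_vector c x = arc_derivative c (unit_tangent c) x"

definition arclength_parametrized :: "(real \<Rightarrow> 'a::real_inner) \<Rightarrow> bool" where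
  "arclength_parametrized c \<longleftrightarrow> (\<forall>x. norm (vector_derivative c (at x)) = 1)"

subsection \<open>Parallel frames\<close>

definition parallel_frame ::
  "(real \<Rightarrow> real^('m::finite option)) \<Rightarrow> (real \<Rightarrow> real^('m option)^('m option)) \<Rightarrow> bool" where
  "parallel_frame c g \<longleftrightarrow>
     smooth g \<and>
     (\<forall>x. rotation_matrix (g x)) \<and>
     (\<forall>x. column None (g x) = vector_derivative c (at x)) \<and>
     (\<forall>i x. normal_connection c (\<lambda>s. column (Some i) (g s)) x = 0)"

text \<open>The coefficients \<open>k\<^sub>i\<close> of the expansion of \<open>(e\<^sub>1)\<^sub>x\<close> in the orthonormal normal frame.\<close>
definition principal_curvatures ::
  "(real \<Rightarrow> real^('m::finite option)^('m option)) \<Rightarrow> real \<Rightarrow> real^'m" where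
  "principal_curvatures g x =
     (\<chi> i. vector_derivative (\<lambda>s. column None (g s)) (at x) \<bullet> column (Some i) (g x))"

subsection \<open>The matrix system\<close>

text \<open>The block matrix with rows \<open>(0, - v\<^sup>T)\<close> and \<open>(v, M)\<close>.\<close>
definition block_matrix :: "real^'m \<Rightarrow> real^'m^'m \<Rightarrow> real^('m::finite option)^('m option)" where
  "block_matrix v M = (\<chi> a b.
     case a of
       None \<Rightarrow> (case b of None \<Rightarrow> 0 | Some j \<Rightarrow> - v $ j)
     | Some i \<Rightarrow> (case b of None \<Rightarrow> v $ i | Some j \<Rightarrow> M $ i $ j))"

definition z_coeff :: "(real \<Rightarrow> real \<Rightarrow> real^'m::finite) \<Rightarrow> real \<Rightarrow> real \<Rightarrow> real^'m" where
  "z_coeff k x t =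
     - (partial_x (partial_x k) x t + ((norm (k x t))\<^sup>2 / 2) *\<^sub>R k x t)"

definition xi_coeff :: "(real \<Rightarrow> real \<Rightarrow> real^'m::finite) \<Rightarrow> real \<Rightarrow> real \<Rightarrow> real^'m^'m" where
  "xi_coeff k x t =
     (\<chi> i j. partial_x k x t $ i * k x t $ j - k x t $ i * partial_x k x t $ j)"

definition airy_frame ::
  "(real \<Rightarrow> real \<Rightarrow> real^'m::finite) \<Rightarrow> real^('m option)^('m option)
     \<Rightarrow> (real \<Rightarrow> real \<Rightarrow> real^('m option)^('m option)) \<Rightarrow> bool" where
  "airy_frame k G g \<longleftrightarrow>
     (\<forall>x t. rotation_matrix (g x t)) \<and>
     (\<forall>x t. (\<lambda>s. g s t) differentiable (at x) \<and> (\<lambda>r. g x r) differentiable (at t)) \<and>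
     (\<forall>x t. matrix_inv (g x t) ** partial_x g x t = block_matrix (k x t) 0) \<and>
     (\<forall>x t. matrix_inv (g x t) ** partial_t g x t = block_matrix (z_coeff k x t) (xi_coeff k x t)) \<and>
     g 0 0 = G"

subsection \<open>The two evolution equations\<close>

definition vmKdV_solution :: "(real \<Rightarrow> real \<Rightarrow> real^'m::finite) \<Rightarrow> bool" where
  "vmKdV_solution k \<longleftrightarrow>
     smooth2 k \<and>
     (\<forall>x t. partial_t k x t =
        - (partial_x (partial_x (partial_x k)) x t
           + (3 / 2 * (norm (k x t))\<^sup>2) *\<^sub>R partial_x k x t))"

definition geometric_airy_flow :: "(real \<Rightarrow> real \<Rightarrow> 'a::real_inner) \<Rightarrow> bool" where
  "geometric_airy_flow \<gamma> \<longleftrightarrow>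
     smooth2 \<gamma> \<and>
     (\<forall>x t. partial_x \<gamma> x t \<noteq> 0) \<and>
     (\<forall>x t. let c = (\<lambda>s. \<gamma> s t); H = curvature_vector c in
        partial_t \<gamma> x t =
          - (((norm (H x))\<^sup>2 / 2) *\<^sub>R unit_tangent c x + normal_connection c H x))"

subsection \<open>The curves reconstructed from a frame\<close>

definition Z_field ::
  "(real \<Rightarrow> real \<Rightarrow> real^'m::finite) \<Rightarrow> (real \<Rightarrow> real \<Rightarrow> real^('m option)^('m option))
     \<Rightarrow> real \<Rightarrow> real \<Rightarrow> real^('m option)" where
  "Z_field k g x t =
     - (((norm (k x t))\<^sup>2 / 2) *\<^sub>R column None (g x t)
        + (\<Sum>i\<in>UNIV. (partial_x k x t $ i) *\<^sub>R column (Some i) (g x t)))"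

text \<open>
  The interval integral is oriented, hence also covers negative \<open>x\<close> and \<open>t\<close>.
\<close>
definition reconstructed_curve ::
  "real^('m option) \<Rightarrow> (real \<Rightarrow> real \<Rightarrow> real^'m::finite)
     \<Rightarrow> (real \<Rightarrow> real \<Rightarrow> real^('m option)^('m option)) \<Rightarrow> real \<Rightarrow> real \<Rightarrow> real^('m option)" where
  "reconstructed_curve p k g x t =
     p + (LBINT t1=0..t. Z_field k g 0 t1) + (LBINT s=0..x. column None (g s t))"

end

theory Submission
  imports Defs
begin

text \<open>
  Write the system as \<open>g\<^sub>x = g A\<close>, \<open>g\<^sub>t = g B\<close> with skew-symmetric \<open>A\<close> and \<open>B\<close>. The vmKdV equation is
  its zero curvature condition \<open>A\<^sub>t + B A = B\<^sub>x + A B\<close>. A linear ODE in \<open>t\<close> gives \<open>g(0, t)\<close>, and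
  linear ODEs in \<open>x\<close> then give \<open>g(x, t)\<close>; skew-symmetry keeps the solutions in \<open>SO(n)\<close> and yields
  uniqueness, since \<open>u v\<^sup>T\<close> is constant for two solutions \<open>u\<close>, \<open>v\<close> of the same equation. That the
  resulting \<open>g\<close> satisfies the \<open>t\<close>-equation as well is read off the first-order Taylor error
  \<open>D = g(x, t + h) - g(x, t) - h g B\<close>: by zero curvature its \<open>x\<close>-derivative is \<open>D A(x, t + h)\<close> up to
  \<open>o(h)\<close>, so \<open>D = o(h)\<close> propagates from \<open>x = 0\<close>. No differentiable dependence of ODE solutions on
  parameters is needed, and smoothness of \<open>g\<close> follows by bootstrapping, because its partial
  derivatives are \<open>g A\<close> and \<open>g B\<close>. Finally \<open>Z\<^sub>x = (e\<^sub>1)\<^sub>t\<close>, so that \<open>\<gamma>\<^sub>t = Z\<close>, which is the Airy flow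
  expressed in the moving frame.
\<close>

subsection \<open>Smooth functions of two variables\<close>

lemma C_class_SucI:
  assumes "\<And>p. (f has_derivative f' p) (at p)"
    and "\<And>v. C_class n (\<lambda>p. f' p v)"
  shows "C_class (Suc n) f"
proof -
  have "frechet_derivative f (at p) = f' p" for p
    using assms(1) by (metis frechet_derivative_at)
  then show ?thesis
    using assms by (auto simp: differentiable_def)
qed

lemma C_class_SucD:
  assumes "C_class (Suc n) f"
  shows "(f has_derivative frechet_derivative f (at p)) (at p)"
    and "C_class n (\<lambda>p. frechet_derivative f (at p) v)"
  using assms by (auto simp: frechet_derivative_works)

lemma C_class_mono_Suc: "C_class (Suc n) f \<Longrightarrow> C_class n f"
proof (induction n arbitrary: f)
  case 0
  then show ?case
    by (auto intro!: differentiable_imp_continuous_on simp: differentiable_on_def)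
next
  case (Suc n)
  show ?case
    by (rule C_class_SucI[OF C_class_SucD(1)[OF Suc.prems]])
      (rule Suc.IH[OF C_class_SucD(2)[OF Suc.prems]])
qed

lemma C_class_const: "C_class n (\<lambda>p. c)"
proof (induction n arbitrary: c)
  case (Suc n)
  show ?case by (rule C_class_SucI[OF has_derivative_const Suc])
qed simp

lemma C_class_add:
  "C_class n f \<Longrightarrow> C_class n g \<Longrightarrow> C_class n (\<lambda>p. f p + g p)"
proof (induction n arbitrary: f g)
  case (Suc n)
  show ?case
    by (rule C_class_SucI)
      (rule has_derivative_add C_class_SucD[OF Suc.prems(1)] C_class_SucD[OF Suc.prems(2)] Suc.IH)+
qed (simp add: continuous_on_add)

lemma C_class_bounded_linear:
  assumes "bounded_linear h"
  shows "C_class n f \<Longrightarrow> C_class n (\<lambda>p. h (f p))"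
proof (induction n arbitrary: f)
  case 0
  then show ?case
    using bounded_linear.continuous_on[OF assms] by simp
next
  case (Suc n)
  show ?case
    by (rule C_class_SucI)
      (rule bounded_linear.has_derivative[OF assms] C_class_SucD[OF Suc.prems] Suc.IH)+
qed

text \<open>The product rule writes the derivative as a sum of two products, each with one
  differentiated factor. The other factor has to be lowered from class \<open>Suc n\<close> to class
  \<open>n\<close> before the induction hypothesis applies.\<close>

lemma C_class_bounded_bilinear:
  assumes "bounded_bilinear mul"
  shows "C_class n f \<Longrightarrow> C_class n g \<Longrightarrow> C_class n (\<lambda>p. mul (f p) (g p))"
proof (induction n arbitrary: f g)
  case 0
  then show ?case
    using bounded_bilinear.continuous_on[OF assms] by simp
next
  case (Suc n)
  show ?case
    by (rule C_class_SucI)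
      (rule bounded_bilinear.FDERIV[OF assms] C_class_SucD[OF Suc.prems(1)]
        C_class_SucD[OF Suc.prems(2)] C_class_add Suc.IH C_class_mono_Suc[OF Suc.prems(1)]
        C_class_mono_Suc[OF Suc.prems(2)])+
qed

lemma smooth_frechet_derivative: "smooth f \<Longrightarrow> smooth (\<lambda>p. frechet_derivative f (at p) v)"
  unfolding smooth_def using C_class_SucD(2) by blast

lemma smooth_has_derivative:
  "smooth f \<Longrightarrow> (f has_derivative frechet_derivative f (at p)) (at p)"
  unfolding smooth_def using C_class_SucD(1) by blast

lemma smooth_has_vector_derivative:
  fixes f :: "real \<Rightarrow> 'a::real_normed_vector"
  assumes "smooth f"
  shows "(f has_vector_derivative vector_derivative f (at x)) (at x)"
  using smooth_has_derivative[OF assms] vector_derivative_works differentiable_def by blast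

section \<open>Functions of two real variables and their partial derivatives\<close>

lemma smooth2_continuous: "smooth2 f \<Longrightarrow> continuous_on UNIV (\<lambda>(x, t). f x t)"
  unfolding smooth2_def smooth_def by (metis C_class.simps(1))

lemma smooth2_const: "smooth2 (\<lambda>x t. c)"
  unfolding smooth2_def smooth_def by (simp add: case_prod_unfold C_class_const)

lemma smooth2_add: "smooth2 f \<Longrightarrow> smooth2 g \<Longrightarrow> smooth2 (\<lambda>x t. f x t + g x t)"
  unfolding smooth2_def smooth_def by (simp add: case_prod_unfold C_class_add)

lemma smooth2_bounded_linear:
  "bounded_linear h \<Longrightarrow> smooth2 f \<Longrightarrow> smooth2 (\<lambda>x t. h (f x t))"
  unfolding smooth2_def smooth_def by (auto simp: case_prod_unfold intro!: C_class_bounded_linear[of h])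

lemma smooth2_bounded_bilinear:
  "bounded_bilinear mul \<Longrightarrow> smooth2 f \<Longrightarrow> smooth2 g \<Longrightarrow> smooth2 (\<lambda>x t. mul (f x t) (g x t))"
  unfolding smooth2_def smooth_def by (auto simp: case_prod_unfold intro!: C_class_bounded_bilinear[of mul])

lemma smooth2_minus: "smooth2 f \<Longrightarrow> smooth2 (\<lambda>x t. - f x t)"
  by (rule smooth2_bounded_linear[OF bounded_linear_minus[OF bounded_linear_ident]])

lemma smooth2_diff: "smooth2 f \<Longrightarrow> smooth2 g \<Longrightarrow> smooth2 (\<lambda>x t. f x t - g x t)"
  using smooth2_add[of f "\<lambda>x t. - g x t"] smooth2_minus[of g] by simp

lemma has_vector_derivative_partials:
  fixes f :: "real \<Rightarrow> real \<Rightarrow> 'a::real_normed_vector"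
  assumes "((\<lambda>(x, t). f x t) has_derivative D) (at (x, t))"
  shows "((\<lambda>s. f s t) has_vector_derivative D (1, 0)) (at x)"
    and "((\<lambda>r. f x r) has_vector_derivative D (0, 1)) (at t)"
proof -
  interpret bounded_linear D using assms by (rule has_derivative_bounded_linear)
  have "(\<lambda>h. D (h, 0)) = (\<lambda>h. h *\<^sub>R D (1, 0))"
    by (intro ext) (metis scaleR scaleR_Pair mult.right_neutral real_scaleR_def scaleR_zero_right)
  moreover have "((\<lambda>s. (s, t)) has_derivative (\<lambda>h. (h, 0))) (at x)"
    by (auto intro!: derivative_eq_intros)
  from has_derivative_compose[OF this assms]
  have "((\<lambda>s. f s t) has_derivative (\<lambda>h. D (h, 0))) (at x)" by simp
  ultimately show "((\<lambda>s. f s t) has_vector_derivative D (1, 0)) (at x)"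
    unfolding has_vector_derivative_def by (simp only:)
  have "(\<lambda>h. D (0, h)) = (\<lambda>h. h *\<^sub>R D (0, 1))"
    by (intro ext) (metis scaleR scaleR_Pair mult.right_neutral real_scaleR_def scaleR_zero_right)
  moreover have "((\<lambda>r. (x, r)) has_derivative (\<lambda>h. (0, h))) (at t)"
    by (auto intro!: derivative_eq_intros)
  from has_derivative_compose[OF this assms]
  have "((\<lambda>r. f x r) has_derivative (\<lambda>h. D (0, h))) (at t)" by simp
  ultimately show "((\<lambda>r. f x r) has_vector_derivative D (0, 1)) (at t)"
    unfolding has_vector_derivative_def by (simp only:)
qed

lemma smooth2_partials:
  fixes f :: "real \<Rightarrow> real \<Rightarrow> 'a::real_normed_vector"
  assumes "smooth2 f"
  shows "((\<lambda>s. f s t) has_vector_derivative partial_x f x t) (at x)"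
    and "((\<lambda>r. f x r) has_vector_derivative partial_t f x t) (at t)"
    and "smooth2 (partial_x f)" and "smooth2 (partial_t f)"
proof -
  define D where "D p = frechet_derivative (\<lambda>(x, t). f x t) (at p)" for p
  have "((\<lambda>(x, t). f x t) has_derivative D p) (at p)" for p
    unfolding D_def using assms by (intro smooth_has_derivative) (simp add: smooth2_def)
  note * = has_vector_derivative_partials[OF this]
  have px: "partial_x f x t = D (x, t) (1, 0)" and pt: "partial_t f x t = D (x, t) (0, 1)" for x t
    using * by (auto simp: partial_x_def partial_t_def intro!: vector_derivative_at)
  show "((\<lambda>s. f s t) has_vector_derivative partial_x f x t) (at x)"
    "((\<lambda>r. f x r) has_vector_derivative partial_t f x t) (at t)"
    unfolding px pt by (rule *)+
  show "smooth2 (partial_x f)" "smooth2 (partial_t f)"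
    using smooth_frechet_derivative assms
    by (auto simp: smooth2_def case_prod_unfold px pt D_def)
qed

lemma has_derivative_continuous_partials:
  fixes f :: "real \<Rightarrow> real \<Rightarrow> 'a::real_normed_vector"
  assumes "\<And>x t. ((\<lambda>s. f s t) has_vector_derivative f1 x t) (at x)"
    and "\<And>x t. ((\<lambda>r. f x r) has_vector_derivative f2 x t) (at t)"
    and "continuous_on UNIV (\<lambda>(x, t). f2 x t)"
  shows "((\<lambda>(x, t). f x t) has_derivative (\<lambda>(u, v). u *\<^sub>R f1 x t + v *\<^sub>R f2 x t)) (at (x, t))"
proof -
  \<comment> \<open>The criterion \<open>has_derivative_partialsI\<close> expects the second partial
    derivative as a continuous family of bounded linear maps, so the vector \<open>f2 x t\<close> is
    replaced by the map that scales it.\<close>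
  have "continuous (at (x, t)) (\<lambda>p. blinfun_scaleR_left ((\<lambda>(x, t). f2 x t) p))"
    using assms(3) bounded_linear.continuous[OF bounded_linear_blinfun_scaleR_left]
    by (metis continuous_on_eq_continuous_at iso_tuple_UNIV_I open_UNIV)
  then have "((\<lambda>(x, t). f x t) has_derivative
      (\<lambda>(u, v). u *\<^sub>R f1 x t + blinfun_scaleR_left (f2 x t) v)) (at (x, t) within UNIV \<times> UNIV)"
    using assms(1,2) by (intro has_derivative_partialsI)
      (auto simp: has_vector_derivative_def case_prod_unfold)
  then show ?thesis by (simp add: case_prod_unfold)
qed

text \<open>One step of the regularity bootstrap: every directional derivative is a fixed linear
  combination of the two partial derivatives, so their class passes to it.\<close>

lemma C_class_Suc_partials:
  fixes f :: "real \<Rightarrow> real \<Rightarrow> 'a::real_normed_vector"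
  assumes "\<And>x t. ((\<lambda>s. f s t) has_vector_derivative f1 x t) (at x)"
    and "\<And>x t. ((\<lambda>r. f x r) has_vector_derivative f2 x t) (at t)"
    and "C_class n (\<lambda>(x, t). f1 x t)" and "C_class n (\<lambda>(x, t). f2 x t)"
  shows "C_class (Suc n) (\<lambda>(x, t). f x t)"
proof (rule C_class_SucI)
  have "continuous_on UNIV (\<lambda>(x, t). f2 x t)"
    using assms(4) by (induction n) (auto dest: C_class_mono_Suc simp del: C_class.simps(2))
  then show "((\<lambda>(x, t). f x t) has_derivative (\<lambda>(u, v). u *\<^sub>R f1 (fst p) (snd p) + v *\<^sub>R f2 (fst p) (snd p))) (at p)" for p
    using has_derivative_continuous_partials[OF assms(1,2)] by (cases p) simp
  show "C_class n (\<lambda>p. (\<lambda>(u, v). u *\<^sub>R f1 (fst p) (snd p) + v *\<^sub>R f2 (fst p) (snd p)) w)" for w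
    using assms(3,4)
    by (cases w) (simp add: case_prod_unfold C_class_add C_class_bounded_linear[OF bounded_linear_scaleR_right])
qed

lemma smooth2_of_partials:
  fixes f :: "real \<Rightarrow> real \<Rightarrow> 'a::real_normed_vector"
  assumes "\<And>x t. ((\<lambda>s. f s t) has_vector_derivative f1 x t) (at x)"
    and "\<And>x t. ((\<lambda>r. f x r) has_vector_derivative f2 x t) (at t)"
    and "smooth2 f1" and "smooth2 f2"
  shows "smooth2 f"
  unfolding smooth2_def smooth_def
proof
  fix n
  have "C_class (Suc n) (\<lambda>(x, t). f x t)"
    using assms by (intro C_class_Suc_partials) (auto simp: smooth2_def smooth_def)
  then show "C_class n (\<lambda>(x, t). f x t)" by (rule C_class_mono_Suc)
qed

section \<open>Mean value estimates\<close>

lemma vector_differentiable_bound: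
  fixes f :: "real \<Rightarrow> 'a::real_normed_vector"
  assumes "convex S" and "\<And>s. s \<in> S \<Longrightarrow> (f has_vector_derivative f' s) (at s)"
    and "\<And>s. s \<in> S \<Longrightarrow> norm (f' s) \<le> C" and "a \<in> S" and "b \<in> S"
  shows "norm (f b - f a) \<le> C * \<bar>b - a\<bar>"
proof -
  have "onorm (\<lambda>h. h *\<^sub>R f' s) \<le> C" if "s \<in> S" for s
    using assms(3)[OF that] by (intro onorm_le) (simp add: mult.commute[of C] mult_left_mono)
  then have "norm (f b - f a) \<le> C * norm (b - a)"
    using assms by (intro differentiable_bound[of S f "\<lambda>s h. h *\<^sub>R f' s"])
      (auto simp: has_vector_derivative_def has_derivative_at_withinI)
  then show ?thesis by simp
qed

text \<open>Moving parallel to one axis at a time, two mean value estimates give a local Lipschitz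
  bound. This starts the bootstrap for a frame, whose partial derivatives are known to be locally
  bounded before they are known to be continuous.\<close>

lemma continuous_on_bounded_partials:
  fixes f :: "real \<Rightarrow> real \<Rightarrow> 'a::real_normed_vector"
  assumes f1: "\<And>x t. ((\<lambda>s. f s t) has_vector_derivative f1 x t) (at x)"
    and f2: "\<And>x t. ((\<lambda>r. f x r) has_vector_derivative f2 x t) (at t)"
    and bound: "\<And>R. \<exists>C. \<forall>x t. \<bar>x\<bar> \<le> R \<longrightarrow> \<bar>t\<bar> \<le> R \<longrightarrow> norm (f1 x t) \<le> C \<and> norm (f2 x t) \<le> C"
  shows "continuous_on UNIV (\<lambda>(x, t). f x t)"
proof -
  have "isCont (\<lambda>(x, t). f x t) (x0, t0)" for x0 t0
  proof -
    \<comment> \<open>The summand 1 keeps both legs of the path, for points within distance 1 of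
      \<open>(x0, t0)\<close>, inside the square where \<open>C\<close> is a bound.\<close>
    define R where "R = \<bar>x0\<bar> + \<bar>t0\<bar> + 1"
    obtain C where C: "\<And>x t. \<bar>x\<bar> \<le> R \<Longrightarrow> \<bar>t\<bar> \<le> R \<Longrightarrow> norm (f1 x t) \<le> C \<and> norm (f2 x t) \<le> C"
      using bound by meson
    have bd: "norm (f x t - f x0 t0) \<le> C * \<bar>x - x0\<bar> + C * \<bar>t - t0\<bar>"
      if "\<bar>x - x0\<bar> \<le> 1" "\<bar>t - t0\<bar> \<le> 1" for x t
    proof -
      have x: "\<bar>x\<bar> \<le> R" "\<bar>x0\<bar> \<le> R" and t: "\<bar>t\<bar> \<le> R" "\<bar>t0\<bar> \<le> R"
        using that unfolding R_def by linarith+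
      have "norm (f x t - f x0 t) \<le> C * \<bar>x - x0\<bar>"
        using C x t
        by (intro vector_differentiable_bound[of "{-R..R}" "\<lambda>s. f s t", OF _ f1])
          (auto simp: abs_le_iff)
      moreover have "norm (f x0 t - f x0 t0) \<le> C * \<bar>t - t0\<bar>"
        using C x t
        by (intro vector_differentiable_bound[of "{-R..R}" "\<lambda>r. f x0 r", OF _ f2])
          (auto simp: abs_le_iff)
      ultimately show ?thesis
        using norm_triangle_ineq[of "f x t - f x0 t" "f x0 t - f x0 t0"] by simp
    qed
    have "\<forall>\<^sub>F p in at (x0, t0). dist p (x0, t0) < 1"
      by (rule eventually_at_ball'[THEN eventually_mono]) (auto simp: dist_commute)
    then have "\<forall>\<^sub>F p in at (x0, t0). norm ((\<lambda>(x, t). f x t) p - f x0 t0)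
        \<le> C * \<bar>fst p - x0\<bar> + C * \<bar>snd p - t0\<bar>"
    proof eventually_elim
      case (elim p)
      then show ?case
        using bd[of "fst p" "snd p"] dist_fst_le[of p "(x0, t0)"] dist_snd_le[of p "(x0, t0)"]
        by (cases p) (auto simp: dist_real_def)
    qed
    moreover have "((\<lambda>p. C * \<bar>fst p - x0\<bar> + C * \<bar>snd p - t0\<bar>) \<longlongrightarrow> 0) (at (x0, t0))"
      by (auto intro!: tendsto_eq_intros)
    ultimately have "((\<lambda>p. (\<lambda>(x, t). f x t) p - f x0 t0) \<longlongrightarrow> 0) (at (x0, t0))"
      by (rule Lim_null_comparison)
    then show ?thesis
      by (simp add: isCont_def LIM_zero_iff)
  qed
  then show ?thesis
    by (simp add: continuous_on_eq_continuous_at split_paired_all)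
qed

subsection \<open>Taylor errors and linear differential equations\<close>

text \<open>Differentiability as smallness of the Taylor error, in a form with a non-strict bound
  that passes directly through norm estimates.\<close>

lemma has_vector_derivative_iff_eventually:
  fixes f :: "real \<Rightarrow> 'a::real_normed_vector"
  shows "(f has_vector_derivative f') (at t) \<longleftrightarrow>
    (\<forall>e>0. \<forall>\<^sub>F h in at 0. norm (f (t + h) - f t - h *\<^sub>R f') \<le> e * \<bar>h\<bar>)"
  unfolding has_vector_derivative_def has_derivative_within_alt2 eventually_at_to_0[of _ t]
  by (simp add: bounded_linear_scaleR_left add.commute)

lemma continuous_uniform_slices:
  fixes a :: "real \<Rightarrow> real \<Rightarrow> 'a::real_normed_vector"
  assumes "continuous_on UNIV (\<lambda>(x, t). a x t)" and "e > 0"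
  obtains d where "d > 0"
    and "\<And>x h. \<bar>x\<bar> \<le> X \<Longrightarrow> \<bar>h\<bar> < d \<Longrightarrow> norm (a x (t + h) - a x t) \<le> e"
proof -
  let ?K = "{-X..X} \<times> {t - 1..t + 1}"
  have "uniformly_continuous_on ?K (\<lambda>(x, t). a x t)"
    by (intro compact_uniformly_continuous continuous_on_subset[OF assms(1)] compact_Times) auto
  then obtain d where "d > 0" and d: "\<And>p q. p \<in> ?K \<Longrightarrow> q \<in> ?K \<Longrightarrow> dist q p < d
      \<Longrightarrow> dist ((\<lambda>(x, t). a x t) q) ((\<lambda>(x, t). a x t) p) < e"
    unfolding uniformly_continuous_on_def using assms(2) by metis
  show thesis
  proof
    \<comment> \<open>The bound 1 keeps \<open>(x, t + h)\<close> inside the compact rectangle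
      \<open>?K\<close>.\<close>
    show "min d 1 > 0" using \<open>d > 0\<close> by simp
    fix x h :: real assume "\<bar>x\<bar> \<le> X" "\<bar>h\<bar> < min d 1"
    then show "norm (a x (t + h) - a x t) \<le> e"
      using d[of "(x, t)" "(x, t + h)"]
      by (intro less_imp_le) (simp add: dist_Pair_Pair dist_norm, linarith)
  qed
qed

text \<open>The error is controlled by the oscillation of \<open>b x\<close> between
  \<open>t\<close> and \<open>t + h\<close>, and uniform continuity on a compact rectangle bounds
  that for all \<open>x\<close> in the interval at once.\<close>

lemma uniform_partial_t:
  fixes a :: "real \<Rightarrow> real \<Rightarrow> 'a::real_normed_vector"
  assumes "\<And>x t. ((\<lambda>r. a x r) has_vector_derivative b x t) (at t)"
    and "continuous_on UNIV (\<lambda>(x, t). b x t)" and "e > 0"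
  shows "\<forall>\<^sub>F h in at 0. \<forall>x. \<bar>x\<bar> \<le> X \<longrightarrow> norm (a x (t + h) - a x t - h *\<^sub>R b x t) \<le> e * \<bar>h\<bar>"
proof -
  obtain d where "d > 0"
    and d: "\<And>x h. \<bar>x\<bar> \<le> X \<Longrightarrow> \<bar>h\<bar> < d \<Longrightarrow> norm (b x (t + h) - b x t) \<le> e"
    using continuous_uniform_slices[OF assms(2,3)] by metis
  have "norm (a x (t + h) - a x t - h *\<^sub>R b x t) \<le> e * \<bar>h\<bar>" if "\<bar>x\<bar> \<le> X" "\<bar>h\<bar> < d" for x h
  proof -
    have "norm (b x r - b x t) \<le> e" if "r \<in> closed_segment t (t + h)" for r
      using that d[of x "r - t"] \<open>\<bar>x\<bar> \<le> X\<close> \<open>\<bar>h\<bar> < d\<close>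
      by (auto simp: closed_segment_eq_real_ivl split: if_splits)
    then have "norm (a x (t + h) - a x t - (t + h - t) *\<^sub>R b x t) \<le> norm (t + h - t) * e"
      by (intro vector_differentiable_bound_linearization[where S = "closed_segment t (t + h)"])
        (auto intro: has_vector_derivative_at_within assms(1))
    then show ?thesis by (simp add: mult.commute)
  qed
  then show ?thesis
    unfolding eventually_at using \<open>d > 0\<close> by (auto simp: dist_real_def)
qed

text \<open>Integration from 0 to \<open>x\<close> multiplies the uniform bound on the derivative by
  at most the length of the interval, so an error of order \<open>o(h)\<close> at 0 stays of order
  \<open>o(h)\<close>.\<close>

lemma small_error_propagates:
  fixes E :: "real \<Rightarrow> real \<Rightarrow> 'a::real_normed_vector"
  assumes "\<And>s h. ((\<lambda>s. E s h) has_vector_derivative E' s h) (at s)"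
    and "\<And>e. e > 0 \<Longrightarrow> \<forall>\<^sub>F h in at 0. \<forall>s. \<bar>s\<bar> \<le> \<bar>x\<bar> \<longrightarrow> norm (E' s h) \<le> e * \<bar>h\<bar>"
    and "\<And>e. e > 0 \<Longrightarrow> \<forall>\<^sub>F h in at 0. norm (E 0 h) \<le> e * \<bar>h\<bar>"
    and "e > 0"
  shows "\<forall>\<^sub>F h in at 0. norm (E x h) \<le> e * \<bar>h\<bar>"
proof -
  \<comment> \<open>Half of \<open>e\<close> is spent on the integration and half on the initial
    error; adding 1 to the length avoids division by zero at \<open>x = 0\<close>.\<close>
  let ?e = "e / (2 * (\<bar>x\<bar> + 1))"
  have e: "?e > 0" "e / 2 > 0" using \<open>e > 0\<close> by auto
  show ?thesis
    using assms(2)[OF e(1)] assms(3)[OF e(2)]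
  proof eventually_elim
    case (elim h)
    have "norm (E x h - E 0 h) \<le> (?e * \<bar>h\<bar>) * \<bar>x - 0\<bar>"
      using elim(1)
      by (intro vector_differentiable_bound[where S = "{-\<bar>x\<bar>..\<bar>x\<bar>}" and f = "\<lambda>s. E s h", OF _ assms(1)])
        (auto simp: abs_le_iff)
    also have "\<dots> = (?e * \<bar>x\<bar>) * \<bar>h\<bar>" by simp
    also have "\<dots> \<le> (e / 2) * \<bar>h\<bar>"
      using \<open>e > 0\<close> by (intro mult_right_mono) (auto simp: field_simps)
    finally show ?case
      using elim(2) norm_triangle_ineq[of "E x h - E 0 h" "E 0 h"] by simp
  qed
qed

text \<open>A differential form of differentiation under the integral sign: \<open>q\<close> has the
  mixed derivative \<open>b\<close> as its x-derivative, so a t-derivative known only at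
  \<open>x = 0\<close> is carried to every \<open>x\<close>.\<close>

lemma has_vector_derivative_partial_t_transfer:
  fixes f :: "real \<Rightarrow> real \<Rightarrow> 'a::real_normed_vector"
  assumes f: "\<And>x t. ((\<lambda>s. f s t) has_vector_derivative a x t) (at x)"
    and a: "\<And>x t. ((\<lambda>r. a x r) has_vector_derivative b x t) (at t)"
    and b: "continuous_on UNIV (\<lambda>(x, t). b x t)"
    and q: "\<And>x t. ((\<lambda>s. q s t) has_vector_derivative b x t) (at x)"
    and f0: "((\<lambda>r. f 0 r) has_vector_derivative q 0 t) (at t)"
  shows "((\<lambda>r. f x r) has_vector_derivative q x t) (at t)"
  unfolding has_vector_derivative_iff_eventually
proof (intro allI impI)
  fix e :: real assume "e > 0"
  show "\<forall>\<^sub>F h in at 0. norm (f x (t + h) - f x t - h *\<^sub>R q x t) \<le> e * \<bar>h\<bar>"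
  proof (rule small_error_propagates[where E = "\<lambda>s h. f s (t + h) - f s t - h *\<^sub>R q s t"
        and E' = "\<lambda>s h. a s (t + h) - a s t - h *\<^sub>R b s t"])
    show "((\<lambda>s. f s (t + h) - f s t - h *\<^sub>R q s t) has_vector_derivative
        a s (t + h) - a s t - h *\<^sub>R b s t) (at s)" for s h
      by (intro has_vector_derivative_diff f bounded_linear.has_vector_derivative[OF bounded_linear_scaleR_right] q)
  qed (use uniform_partial_t[OF a b] f0[unfolded has_vector_derivative_iff_eventually] \<open>e > 0\<close> in auto)
qed

section \<open>Global solutions of linear differential equations\<close>

lemma antiderivative_exists:
  fixes f :: "real \<Rightarrow> 'a::euclidean_space"
  assumes "continuous_on UNIV f"
  shows "\<exists>F. F 0 = 0 \<and> (\<forall>t. (F has_vector_derivative f t) (at t))"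
proof -
  have "isCont f t" for t
    using assms by (simp add: continuous_on_eq_continuous_at)
  then obtain F where F: "\<And>t. (F has_vector_derivative f t) (at t)"
    using einterval_antiderivative[of "-\<infinity>" \<infinity> f] by auto
  have "((\<lambda>t. F t - F 0) has_vector_derivative f t) (at t)" for t
    using has_vector_derivative_diff[OF F has_vector_derivative_const] by simp
  then show ?thesis by (intro exI[of _ "\<lambda>t. F t - F 0"]) auto
qed

text \<open>The inductive step of the Picard estimate; each integration contributes one factor of
  the factorial.\<close>

lemma norm_le_monomial_of_derivative:
  fixes f :: "real \<Rightarrow> 'a::real_normed_vector"
  assumes "\<And>s. (f has_vector_derivative f' s) (at s)" and "f 0 = 0"
    and "\<And>s. \<bar>s\<bar> \<le> T \<Longrightarrow> norm (f' s) \<le> C * \<bar>s\<bar> ^ n" and "\<bar>t\<bar> \<le> T"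
  shows "norm (f t) \<le> C * \<bar>t\<bar> ^ Suc n / Suc n"
proof -
  have pos: "norm (f t) \<le> C * t ^ Suc n / Suc n"
    if f: "\<And>s. (f has_vector_derivative f' s) (at s)" and "f 0 = 0"
      and bd: "\<And>s. \<bar>s\<bar> \<le> T \<Longrightarrow> norm (f' s) \<le> C * \<bar>s\<bar> ^ n" and "t > 0" "t \<le> T"
    for f f' and t :: real
  proof -
    have phi: "((\<lambda>s. C * s ^ Suc n / Suc n) has_vector_derivative C * s ^ n) (at s)" for s :: real
      unfolding has_real_derivative_iff_has_vector_derivative[symmetric]
      by (rule derivative_eq_intros refl | simp add: field_simps del: of_nat_Suc)+
    have "norm (f t - f 0) \<le> C * t ^ Suc n / Suc n - C * 0 ^ Suc n / Suc n"
      using that f phi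
      by (intro differentiable_bound_general[OF \<open>t > 0\<close>, where f = f and f' = f'
            and \<phi> = "\<lambda>s. C * s ^ Suc n / Suc n" and \<phi>' = "\<lambda>s. C * s ^ n"])
        (auto intro!: has_vector_derivative_continuous continuous_at_imp_continuous_on bd[THEN order_trans])
    then show ?thesis using \<open>f 0 = 0\<close> by simp
  qed
  consider "t > 0" | "t = 0" | "t < 0" by linarith
  then show ?thesis
  proof cases
    case 1
    then show ?thesis using pos[of f f' t] assms by auto
  next
    case 2
    then show ?thesis using assms by auto
  next
    case 3
    \<comment> \<open>Negative times are reduced to positive ones by reflection.\<close>
    have "((\<lambda>s. f (- s)) has_vector_derivative - f' (- s)) (at s)" for s
    proof -
      have "(uminus has_vector_derivative - 1) (at s)"
        using has_vector_derivative_minus[OF has_vector_derivative_id[of "at s"]] by simp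
      from vector_diff_chain_at[OF this assms(1)] show ?thesis by (simp add: o_def)
    qed
    moreover have "norm (- f' (- s)) \<le> C * \<bar>s\<bar> ^ n" if "\<bar>s\<bar> \<le> T" for s
      using assms(3)[of "- s"] that by simp
    ultimately show ?thesis
      using pos[of "\<lambda>s. f (- s)" "\<lambda>s. - f' (- s)" "- t"] 3 assms(2,4) by auto
  qed
qed

text \<open>Picard iteration written as a series: \<open>V 0\<close> is the constant
  \<open>u0\<close> and \<open>V (Suc n)\<close> is the integral from 0 of
  \<open>mul (V n) B\<close>. The terms are dominated by those of an exponential series on every
  bounded interval, so linearity gives a solution on the whole line.\<close>

lemma linear_ode_exists:
  fixes mul :: "'a::euclidean_space \<Rightarrow> 'b::real_normed_vector \<Rightarrow> 'a"
  assumes "bounded_bilinear mul" and B: "continuous_on UNIV B"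
  shows "\<exists>u. u 0 = u0 \<and> (\<forall>t. (u has_vector_derivative mul (u t) (B t)) (at t))"
proof -
  interpret bounded_bilinear mul by fact
  obtain I where I: "\<And>f. continuous_on UNIV f \<Longrightarrow>
      I f 0 = (0::'a) \<and> (\<forall>t. (I f has_vector_derivative f t) (at t))"
    using antiderivative_exists by metis
  define V where "V n = rec_nat (\<lambda>t. u0) (\<lambda>n v. I (\<lambda>t. mul (v t) (B t))) n" for n
  have V0: "V 0 = (\<lambda>t. u0)" and VS: "V (Suc n) = I (\<lambda>t. mul (V n t) (B t))" for n
    by (simp_all add: V_def)
  have contV: "continuous_on UNIV (V n)" for n
  proof (induction n)
    case (Suc n)
    then have "continuous_on UNIV (\<lambda>t. mul (V n t) (B t))"
      using B by (rule continuous_on)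
    then show ?case
      unfolding VS by (meson I continuous_at_imp_continuous_on has_vector_derivative_continuous)
  qed (simp add: V0)
  have dV: "V (Suc n) 0 = 0" "(V (Suc n) has_vector_derivative mul (V n t) (B t)) (at t)" for n t
    using I[OF continuous_on[OF contV B]] unfolding VS by auto
  define u where "u t = (\<Sum>n. V n t)" for t
  have "(u has_vector_derivative mul (u t) (B t)) (at t)" for t
  proof -
    \<comment> \<open>A radius exceeding that of \<open>t\<close>, so that \<open>t\<close> is
      interior to the interval \<open>S\<close> on which all bounds hold.\<close>
    define T where "T = \<bar>t\<bar> + 1"
    obtain b where b: "\<And>s. \<bar>s\<bar> \<le> T \<Longrightarrow> norm (B s) \<le> b"
    proof -
      have "bounded (B ` {-T..T})"
        by (intro compact_imp_bounded compact_continuous_image continuous_on_subset[OF B]) auto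
      then obtain b where "\<forall>s\<in>{-T..T}. norm (B s) \<le> b" by (auto simp: bounded_iff)
      then show thesis using that[of b] by (auto simp: abs_le_iff)
    qed
    obtain K where "K > 0" and K: "\<And>v w. norm (mul v w) \<le> norm v * norm w * K"
      using pos_bounded by blast
    define M where "M = b * K"
    have "b \<ge> 0" using order_trans[OF norm_ge_zero b[of 0]] by (simp add: T_def)
    then have "M \<ge> 0" using \<open>K > 0\<close> by (simp add: M_def)
    have M: "norm (mul v (B s)) \<le> M * norm v" if "\<bar>s\<bar> \<le> T" for v s
    proof -
      have "norm (mul v (B s)) \<le> norm v * norm (B s) * K" by (rule K)
      also have "\<dots> \<le> norm v * b * K"
        using b[OF that] \<open>K > 0\<close> by (intro mult_right_mono mult_left_mono) auto
      finally show ?thesis by (simp add: M_def ac_simps)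
    qed
    have Vbound: "norm (V n s) \<le> norm u0 * M ^ n / fact n * \<bar>s\<bar> ^ n" if "\<bar>s\<bar> \<le> T" for n s
      using that
    proof (induction n arbitrary: s)
      case (Suc n)
      have "norm (mul (V n r) (B r)) \<le> (norm u0 * M ^ Suc n / fact n) * \<bar>r\<bar> ^ n" if "\<bar>r\<bar> \<le> T" for r
        using order_trans[OF M[OF that] mult_left_mono[OF Suc.IH[OF that] \<open>M \<ge> 0\<close>]]
        by (simp add: ac_simps)
      from norm_le_monomial_of_derivative[OF dV(2) dV(1) this Suc.prems]
      show ?case by (simp add: field_simps)
    qed (simp add: V0)
    define S where "S = {-T<..<T}"
    define m where "m n = norm u0 * M ^ n / fact n * T ^ n" for n
    have Vm: "norm (V n s) \<le> m n" if "s \<in> S" for n s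
    proof -
      have s: "\<bar>s\<bar> \<le> T" using that by (auto simp: S_def)
      show ?thesis unfolding m_def
        using \<open>M \<ge> 0\<close> s
        by (intro order_trans[OF Vbound[OF s]] mult_left_mono power_mono) auto
    qed
    have "summable (\<lambda>n. norm u0 * (inverse (fact n) * (M * T) ^ n))"
      by (intro summable_mult summable_exp)
    then have "summable m"
      by (simp add: m_def[abs_def] field_simps power_mult_distrib)
    have sums: "(\<lambda>n. V n s) sums u s" if "s \<in> S" for s
      unfolding u_def using Vm[OF that] \<open>summable m\<close>
      by (intro summable_sums summable_comparison_test[of "\<lambda>n. V n s" m]) auto
    have sums1: "(\<lambda>n. V (Suc n) s) sums (u s - u0)" if "s \<in> S" for s
      using sums[OF that] by (subst sums_Suc_iff) (simp add: V0)
    have unif: "uniform_limit S (\<lambda>n s. \<Sum>i<n. V i s) u sequentially"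
      unfolding u_def[abs_def] using Vm \<open>summable m\<close> by (intro Weierstrass_m_test) auto
    have "t \<in> S" by (auto simp: S_def T_def)
    \<comment> \<open>Termwise differentiation is applied to the shifted series, because the
      derivative of \<open>V (Suc n)\<close> is \<open>mul (V n) B\<close>; the derivatives then sum
      to \<open>mul u B\<close>. The constant term \<open>V 0\<close> is added back
      afterwards.\<close>
    have "\<exists>g. \<forall>x\<in>S. (\<lambda>n. V (Suc n) x) sums g x \<and>
        (g has_derivative (\<lambda>h. h *\<^sub>R mul (u x) (B x))) (at x within S)"
    proof (rule has_derivative_series)
      show "convex S" by (simp add: S_def)
      show "(V (Suc n) has_derivative (\<lambda>h. h *\<^sub>R mul (V n x) (B x))) (at x within S)" for n x
        using dV(2) by (simp add: has_vector_derivative_def has_derivative_at_withinI)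
      show "\<forall>\<^sub>F n in sequentially. \<forall>x\<in>S. \<forall>h.
          norm ((\<Sum>i<n. h *\<^sub>R mul (V i x) (B x)) - h *\<^sub>R mul (u x) (B x)) \<le> e * norm h"
        if "e > 0" for e
      proof -
        \<comment> \<open>Dividing by \<open>M + 1\<close> also covers the case
          \<open>M = 0\<close>.\<close>
        have "e / (M + 1) > 0" using that \<open>M \<ge> 0\<close> by auto
        from uniform_limitD[OF unif this] show ?thesis
        proof eventually_elim
          case (elim n)
          show ?case
          proof (intro ballI allI)
            fix x h assume "x \<in> S"
            let ?d = "(\<Sum>i<n. V i x) - u x"
            have "norm ?d \<le> e / (M + 1)"
              using elim \<open>x \<in> S\<close> by (auto simp: dist_norm intro: less_imp_le)
            have "norm (mul ?d (B x)) \<le> M * norm ?d"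
              using \<open>x \<in> S\<close> by (intro M) (auto simp: S_def)
            also have "\<dots> \<le> (M + 1) * (e / (M + 1))"
              using \<open>norm ?d \<le> _\<close> \<open>M \<ge> 0\<close> by (intro mult_mono) auto
            also have "\<dots> = e" using \<open>M \<ge> 0\<close> by simp
            finally have "norm (mul ?d (B x)) \<le> e" .
            then have "\<bar>h\<bar> * norm (mul ?d (B x)) \<le> e * \<bar>h\<bar>"
              by (simp add: mult.commute[of e] mult_left_mono)
            moreover have "(\<Sum>i<n. h *\<^sub>R mul (V i x) (B x)) - h *\<^sub>R mul (u x) (B x)
                = h *\<^sub>R mul ?d (B x)"
              by (simp add: diff_left sum_left scaleR_sum_right scaleR_diff_right)
            ultimately show "norm ((\<Sum>i<n. h *\<^sub>R mul (V i x) (B x)) - h *\<^sub>R mul (u x) (B x))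
                \<le> e * norm h" by simp
          qed
        qed
      qed
      show "t \<in> S" by fact
      show "(\<lambda>n. V (Suc n) t) sums (u t - u0)" by (rule sums1) fact
    qed
    then obtain g where g: "\<And>x. x \<in> S \<Longrightarrow> (\<lambda>n. V (Suc n) x) sums g x"
      "\<And>x. x \<in> S \<Longrightarrow> (g has_derivative (\<lambda>h. h *\<^sub>R mul (u x) (B x))) (at x within S)"
      by blast
    have "u x = g x + u0" if "x \<in> S" for x
      using sums_unique2[OF g(1) sums1] that by simp
    moreover have "((\<lambda>x. g x + u0) has_derivative (\<lambda>h. h *\<^sub>R mul (u t) (B t))) (at t within S)"
      using has_derivative_add_const[OF g(2)[OF \<open>t \<in> S\<close>]] by blast
    ultimately have "(u has_derivative (\<lambda>h. h *\<^sub>R mul (u t) (B t))) (at t within S)"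
      using \<open>t \<in> S\<close> by (metis (no_types, lifting) has_derivative_transform)
    moreover have "at t within S = at t"
      using \<open>t \<in> S\<close> by (intro at_within_open) (auto simp: S_def)
    ultimately show ?thesis
      by (simp add: has_vector_derivative_def)
  qed
  moreover have "V n 0 = (if n = 0 then u0 else 0)" for n
    by (cases n) (auto simp: V0 dV)
  then have "u 0 = u0"
    unfolding u_def using sums_single[of 0 "\<lambda>n. u0"] by (simp add: sums_unique[symmetric])
  ultimately show ?thesis by blast
qed

subsection \<open>Orthogonal matrices\<close>

lemma bounded_bilinear_matrix_matrix_mult:
  "bounded_bilinear ((**) :: real^'n^'m \<Rightarrow> real^'p^'n \<Rightarrow> real^'p^'m)"
  unfolding bilinear_conv_bounded_bilinear[symmetric] bilinear_def linear_iff
  by (simp add: matrix_matrix_mult_def vec_eq_iff sum.distrib sum_distrib_left algebra_simps)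

lemma bounded_bilinear_matrix_vector_mult:
  "bounded_bilinear ((*v) :: real^'n^'m \<Rightarrow> real^'n \<Rightarrow> real^'m)"
  unfolding bilinear_conv_bounded_bilinear[symmetric] bilinear_def linear_iff
  by (simp add: matrix_vector_mult_def vec_eq_iff sum.distrib sum_distrib_left algebra_simps)

lemma bounded_linear_transpose:
  "bounded_linear (transpose :: real^'n^'m \<Rightarrow> real^'m^'n)"
  unfolding linear_conv_bounded_linear[symmetric] linear_iff
  by (simp add: transpose_def vec_eq_iff)

lemmas mm_derivative = bounded_bilinear.has_vector_derivative[OF bounded_bilinear_matrix_matrix_mult]
lemmas mv_derivative = bounded_bilinear.has_vector_derivative[OF bounded_bilinear_matrix_vector_mult]
lemmas transpose_derivative = bounded_linear.has_vector_derivative[OF bounded_linear_transpose]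

interpretation mm: bounded_bilinear "(**) :: real^'n^'m \<Rightarrow> real^'p^'n \<Rightarrow> real^'p^'m"
  by (rule bounded_bilinear_matrix_matrix_mult)

interpretation mv: bounded_bilinear "(*v) :: real^'n^'m \<Rightarrow> real^'n \<Rightarrow> real^'m"
  by (rule bounded_bilinear_matrix_vector_mult)

text \<open>The rows are unit vectors, and the Euclidean norm of their lengths is at most the sum.
  The bound is crude, but it holds uniformly along any orthogonal frame.\<close>

lemma norm_orthogonal_matrix_le:
  fixes Q :: "real^'n^'n"
  assumes "orthogonal_matrix Q"
  shows "norm Q \<le> CARD('n)"
proof -
  have "norm (Q $ i) = 1" for i
    using assms by (simp add: orthogonal_matrix_orthonormal_rows row_def vec_nth_inverse)
  then show ?thesis
    using L2_set_le_sum[of UNIV "\<lambda>i. norm (Q $ i)"] by (simp add: norm_vec_def)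
qed

lemma continuous_on_det:
  fixes f :: "'a::topological_space \<Rightarrow> real^'n^'n"
  assumes "continuous_on S f"
  shows "continuous_on S (\<lambda>x. det (f x))"
  unfolding det_def by (intro continuous_intros assms)

lemma orthogonal_matrix_inv:
  fixes Q :: "real^'n^'n"
  assumes "orthogonal_matrix Q"
  shows "matrix_inv Q = transpose Q"
proof -
  have "invertible Q"
    using assms unfolding orthogonal_matrix_def invertible_def by blast
  then have "matrix_inv Q ** Q = mat 1"
    unfolding matrix_inv_def invertible_def by (metis (mono_tags, lifting) someI_ex)
  then show ?thesis
    by (metis assms matrix_mul_assoc matrix_mul_lid matrix_mul_rid orthogonal_matrix_def)
qed

lemma orthogonal_matrix_inv_mult_eq_iff:
  fixes Q :: "real^'n^'n"
  assumes "orthogonal_matrix Q"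
  shows "matrix_inv Q ** X = Y \<longleftrightarrow> X = Q ** Y"
  using assms unfolding orthogonal_matrix_inv[OF assms] orthogonal_matrix_def
  by (metis matrix_mul_assoc matrix_mul_lid)

section \<open>Linear equations with skew-symmetric coefficients\<close>

lemma zero_vector_derivative_constant:
  fixes f :: "real \<Rightarrow> 'a::real_normed_vector"
  assumes "\<And>s. (f has_vector_derivative 0) (at s)"
  shows "f s = f r"
  using has_derivative_zero_unique[of UNIV f s r] assms
  by (simp add: has_vector_derivative_def)

context
  fixes u v :: "real \<Rightarrow> real^'n^'n" and B :: "real \<Rightarrow> real^'n^'n"
  assumes u: "\<And>t. (u has_vector_derivative u t ** B t) (at t)"
    and skew: "\<And>t. transpose (B t) = - B t"
begin

text \<open>The product rule gives \<open>u B v^T + u B^T v^T\<close>, which vanishes by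
  skew-symmetry.\<close>

lemma skew_ode_product_constant:
  assumes v: "\<And>t. (v has_vector_derivative v t ** B t) (at t)"
  shows "u t ** transpose (v t) = u 0 ** transpose (v 0)"
proof -
  have "((\<lambda>t. u t ** transpose (v t)) has_vector_derivative 0) (at t)" for t
    using mm_derivative[OF u transpose_derivative[OF v], of t]
    by (simp add: matrix_transpose_mul skew matrix_mul_assoc mm.minus_left mm.minus_right)
  then show ?thesis
    by (rule zero_vector_derivative_constant)
qed

lemma skew_ode_unique:
  assumes v: "\<And>t. (v has_vector_derivative v t ** B t) (at t)"
    and "u 0 = v 0" and "\<And>t. orthogonal_matrix (v t)"
  shows "u t = v t"
proof -
  have "u t ** transpose (v t) = mat 1"
    using skew_ode_product_constant[OF v] assms(2,3) by (simp add: orthogonal_matrix_def)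
  then show ?thesis
    using assms(3)[of t] unfolding orthogonal_matrix_def
    by (metis matrix_mul_assoc matrix_mul_lid matrix_mul_rid)
qed

end

text \<open>Constancy of \<open>u u^T\<close> gives orthogonality. The determinant is then
  continuous with values 1 and -1 only, so it keeps its initial value 1 along the connected
  line.\<close>

lemma skew_ode_rotation_matrix:
  fixes u :: "real \<Rightarrow> real^'n^'n"
  assumes u: "\<And>t. (u has_vector_derivative u t ** B t) (at t)"
    and skew: "\<And>t. transpose (B t) = - B t"
    and "rotation_matrix (u 0)"
  shows "rotation_matrix (u t)"
proof -
  have "u t ** transpose (u t) = mat 1" for t
    using skew_ode_product_constant[OF u skew u] assms(3)
    by (simp add: rotation_matrix_def orthogonal_matrix_def)
  then have orth: "orthogonal_matrix (u t)" for t
    unfolding orthogonal_matrix_def by (simp add: matrix_left_right_inverse)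
  have cont: "continuous_on UNIV (\<lambda>t. det (u t))"
    using u by (intro continuous_on_det)
      (meson continuous_at_imp_continuous_on has_vector_derivative_continuous)
  have "det (u t) \<noteq> 0" for t
    using det_orthogonal_matrix[OF orth[of t]] by auto
  moreover have "connected (range (\<lambda>t. det (u t)))"
    by (intro connected_continuous_image cont connected_UNIV)
  ultimately have "\<not> det (u t) < 0"
    using assms(3) connectedD_interval[of "range (\<lambda>t. det (u t))" "det (u t)" "det (u 0)" 0]
    by (auto simp: rotation_matrix_def)
  then show ?thesis
    using det_orthogonal_matrix[OF orth[of t]] orth by (auto simp: rotation_matrix_def)
qed

subsection \<open>Frames with zero curvature\<close>

text \<open>The hypothesis \<open>flat\<close> is the equality of mixed derivatives,
  \<open>(g A)_t = (g B)_x\<close>, with the factor \<open>g\<close> cancelled. The construction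
  solves along the t-axis and then along horizontal lines, which leaves the t-equation away from
  \<open>x = 0\<close> to be proved.\<close>

lemma flat_frame_exists:
  fixes A B :: "real \<Rightarrow> real \<Rightarrow> real^'n^'n"
  assumes skewA: "\<And>x t. transpose (A x t) = - A x t"
    and skewB: "\<And>x t. transpose (B x t) = - B x t"
    and contA: "continuous_on UNIV (\<lambda>(x, t). A x t)"
    and contB: "continuous_on UNIV (\<lambda>(x, t). B x t)"
    and dA: "\<And>x t. ((\<lambda>r. A x r) has_vector_derivative At x t) (at t)"
    and contAt: "continuous_on UNIV (\<lambda>(x, t). At x t)"
    and dB: "\<And>x t. ((\<lambda>s. B s t) has_vector_derivative Bx x t) (at x)"
    and flat: "\<And>x t. At x t + B x t ** A x t = Bx x t + A x t ** B x t"
    and "rotation_matrix G"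
  shows "\<exists>g. g 0 0 = G \<and> (\<forall>x t. rotation_matrix (g x t)) \<and>
    (\<forall>x t. ((\<lambda>s. g s t) has_vector_derivative g x t ** A x t) (at x)) \<and>
    (\<forall>x t. ((\<lambda>r. g x r) has_vector_derivative g x t ** B x t) (at t))"
proof -
  have slices: "continuous_on UNIV (\<lambda>s. f s t)" "continuous_on UNIV (\<lambda>r. f s r)"
    if "continuous_on UNIV (\<lambda>(x, t). f x t)" for f :: "real \<Rightarrow> real \<Rightarrow> real^'n^'n" and s t
    using continuous_on_compose2[OF that, of UNIV "\<lambda>s. (s, t)"]
      continuous_on_compose2[OF that, of UNIV "\<lambda>r. (s, r)"]
    by (simp_all add: continuous_on_Pair continuous_on_id continuous_on_const)
  obtain w where w: "w 0 = G" "\<And>t. (w has_vector_derivative w t ** B 0 t) (at t)"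
    using linear_ode_exists[OF bounded_bilinear_matrix_matrix_mult slices(2)[OF contB]] by metis
  have "\<exists>u. u 0 = w t \<and> (\<forall>x. (u has_vector_derivative u x ** A x t) (at x))" for t
    by (rule linear_ode_exists[OF bounded_bilinear_matrix_matrix_mult slices(1)[OF contA]])
  then obtain U where U: "\<And>t. U t 0 = w t"
    "\<And>t x. (U t has_vector_derivative U t x ** A x t) (at x)"
    by metis
  define g where "g x t = U t x" for x t
  have g0: "g 0 t = w t" for t by (simp add: g_def U)
  have gx: "((\<lambda>s. g s t) has_vector_derivative g x t ** A x t) (at x)" for x t
    using U(2) by (simp add: g_def)
  have rotw: "rotation_matrix (w t)" for t
    using w(2) skewB by (rule skew_ode_rotation_matrix) (simp add: w \<open>rotation_matrix G\<close>)
  have rot: "rotation_matrix (g x t)" for x t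
    by (rule skew_ode_rotation_matrix[where u = "\<lambda>s. g s t", OF gx skewA]) (simp add: g0 rotw)
  then have orth: "orthogonal_matrix (g x t)" for x t
    by (simp add: rotation_matrix_def)
  obtain K where "K > 0" and K: "\<And>(P :: real^'n^'n) (Q :: real^'n^'n). norm (P ** Q) \<le> norm P * norm Q * K"
    using mm.pos_bounded by blast
  define N where "N = real CARD('n)"
  have N: "norm (g x t) \<le> N" "norm (transpose (g x t)) \<le> N" for x t
    using orth by (auto simp: N_def intro!: norm_orthogonal_matrix_le)
  have "N \<ge> 0" by (simp add: N_def)
  have gt: "((\<lambda>r. g x r) has_vector_derivative g x t ** B x t) (at t)" for x t
  proof -
    define D where "D s h = g s (t + h) - g s t - h *\<^sub>R (g s t ** B s t)" for s h
    \<comment> \<open>\<open>P\<close> is what remains of the s-derivative of \<open>D\<close> after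
      splitting off \<open>D A(s, t + h)\<close>, up to the factor \<open>g\<close>: the Taylor
      error of \<open>A\<close> plus \<open>h B\<close> times the increment of \<open>A\<close>,
      both of order \<open>o(h)\<close>.\<close>
    define P where "P s h = (A s (t + h) - A s t - h *\<^sub>R At s t)
        + h *\<^sub>R (B s t ** (A s (t + h) - A s t))" for s h
    define E where "E s h = D s h ** transpose (g s (t + h))" for s h
    have dD: "((\<lambda>s. D s h) has_vector_derivative
        D s h ** A s (t + h) + g s t ** P s h) (at s)" for s h
    proof -
      \<comment> \<open>Zero curvature enters here: it trades the s-derivative of \<open>g B\<close>
        for \<open>g (B A + At)\<close>, whose terms match those of \<open>g A\<close> at time
        \<open>t + h\<close>.\<close>
      have *: "g s t ** (A s t ** B s t + Bx s t) = g s t ** (B s t ** A s t + At s t)"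
        using flat[of s t] by (simp add: add.commute)
      have "((\<lambda>s. D s h) has_vector_derivative g s (t + h) ** A s (t + h) - g s t ** A s t
          - h *\<^sub>R (g s t ** Bx s t + g s t ** A s t ** B s t)) (at s)"
        unfolding D_def
        by (intro has_vector_derivative_diff gx mm_derivative dB
            bounded_linear.has_vector_derivative[OF bounded_linear_scaleR_right])
      moreover have "g s t ** Bx s t + g s t ** A s t ** B s t = g s t ** (B s t ** A s t + At s t)"
        unfolding *[symmetric] by (simp add: mm.add_right matrix_mul_assoc)
      moreover have "g s (t + h) ** A s (t + h) - g s t ** A s t
          - h *\<^sub>R (g s t ** (B s t ** A s t + At s t)) = D s h ** A s (t + h) + g s t ** P s h"
        unfolding D_def P_def
        by (simp add: mm.add_left mm.add_right mm.diff_left mm.diff_right mm.scaleR_left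
            mm.scaleR_right matrix_mul_assoc algebra_simps)
      ultimately show ?thesis by simp
    qed
    txt \<open>The factor \<open>g\<^sup>T\<close> in \<open>E\<close> cancels the term \<open>D A\<close>, hence Gronwall's inequality is not needed.\<close>
    have dE: "((\<lambda>s. E s h) has_vector_derivative
        g s t ** P s h ** transpose (g s (t + h))) (at s)" for s h
      using mm_derivative[OF dD transpose_derivative[OF gx[of "t + h" s]], of h]
      unfolding E_def
      by (simp add: matrix_transpose_mul skewA mm.add_left mm.minus_left mm.minus_right matrix_mul_assoc)
    obtain b where b: "\<And>s. \<bar>s\<bar> \<le> \<bar>x\<bar> \<Longrightarrow> norm (B s t) \<le> b"
    proof -
      have "bounded ((\<lambda>s. B s t) ` {-\<bar>x\<bar>..\<bar>x\<bar>})"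
        by (intro compact_imp_bounded compact_continuous_image
            continuous_on_subset[OF slices(1)[OF contB]]) auto
      then obtain b where "\<forall>s\<in>{-\<bar>x\<bar>..\<bar>x\<bar>}. norm (B s t) \<le> b" by (auto simp: bounded_iff)
      then show thesis using that[of b] by (auto simp: abs_le_iff)
    qed
    have "b \<ge> 0" using order_trans[OF norm_ge_zero b[of 0]] by simp
    \<comment> \<open>Two factors \<open>N\<close> bound \<open>g\<close> and its transpose, two
      factors \<open>K\<close> come from the two matrix products around \<open>P\<close>, and the
      last factor comes from the bound on \<open>P\<close>.\<close>
    define C where "C = N * K * N * K * (1 + b * K)"
    have "C \<ge> 0" using \<open>K > 0\<close> \<open>N \<ge> 0\<close> \<open>b \<ge> 0\<close> by (simp add: C_def)
    have smallE: "\<forall>\<^sub>F h in at 0. norm (E x h) \<le> e * \<bar>h\<bar>" if "e > 0" for e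
    proof (rule small_error_propagates[where E' = "\<lambda>s h. g s t ** P s h ** transpose (g s (t + h))", OF dE _ _ that])
      fix e :: real assume "e > 0"
      define e' where "e' = e / (C + 1)"
      have "e' > 0" "C * e' \<le> e" using \<open>e > 0\<close> \<open>C \<ge> 0\<close> by (auto simp: e'_def field_simps)
      obtain d where "d > 0"
        and d: "\<And>s h. \<bar>s\<bar> \<le> \<bar>x\<bar> \<Longrightarrow> \<bar>h\<bar> < d \<Longrightarrow> norm (A s (t + h) - A s t) \<le> e'"
        using continuous_uniform_slices[OF contA \<open>e' > 0\<close>] by metis
      have "\<forall>\<^sub>F h in at 0. \<bar>h\<bar> < d"
        unfolding eventually_at using \<open>d > 0\<close> by (auto simp: dist_real_def)
      then show "\<forall>\<^sub>F h in at 0. \<forall>s. \<bar>s\<bar> \<le> \<bar>x\<bar> \<longrightarrow>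
          norm (g s t ** P s h ** transpose (g s (t + h))) \<le> e * \<bar>h\<bar>"
        using uniform_partial_t[OF dA contAt \<open>e' > 0\<close>, of "\<bar>x\<bar>" t]
      proof eventually_elim
        case (elim h)
        show ?case
        proof (intro allI impI)
          fix s assume s: "\<bar>s\<bar> \<le> \<bar>x\<bar>"
          have "norm (B s t ** (A s (t + h) - A s t)) \<le> b * e' * K"
            using b[OF s] d[OF s elim(1)] \<open>K > 0\<close> \<open>b \<ge> 0\<close> \<open>e' > 0\<close>
            by (intro order_trans[OF K] mult_right_mono mult_mono) auto
          then have "norm (h *\<^sub>R (B s t ** (A s (t + h) - A s t))) \<le> \<bar>h\<bar> * (b * e' * K)"
            by (simp add: mult_left_mono)
          moreover have "norm (A s (t + h) - A s t - h *\<^sub>R At s t) \<le> e' * \<bar>h\<bar>"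
            using elim(2) s by blast
          ultimately have P: "norm (P s h) \<le> e' * \<bar>h\<bar> * (1 + b * K)"
            unfolding P_def by (intro order_trans[OF norm_triangle_ineq]) (simp add: algebra_simps)
          have "norm (g s t ** P s h) \<le> N * norm (P s h) * K"
            using N \<open>K > 0\<close> by (intro order_trans[OF K] mult_right_mono) auto
          then have "norm (g s t ** P s h ** transpose (g s (t + h))) \<le> (N * norm (P s h) * K) * N * K"
            using N \<open>K > 0\<close> \<open>N \<ge> 0\<close> by (intro order_trans[OF K] mult_right_mono mult_mono) auto
          also have "\<dots> = (N * K * N * K) * norm (P s h)" by simp
          also have "\<dots> \<le> (N * K * N * K) * (e' * \<bar>h\<bar> * (1 + b * K))"
            using \<open>K > 0\<close> \<open>N \<ge> 0\<close> by (intro mult_left_mono P) auto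
          also have "\<dots> = (C * e') * \<bar>h\<bar>" by (simp add: C_def)
          also have "\<dots> \<le> e * \<bar>h\<bar>" using \<open>C * e' \<le> e\<close> by (intro mult_right_mono) auto
          finally show "norm (g s t ** P s h ** transpose (g s (t + h))) \<le> e * \<bar>h\<bar>" .
        qed
      qed
    next
      fix e :: real assume "e > 0"
      define e' where "e' = e / (N * K + 1)"
      have pos: "N * K + 1 > 0" using \<open>K > 0\<close> \<open>N \<ge> 0\<close> by (simp add: add_nonneg_pos)
      have "e' > 0" "e' * (N * K) \<le> e"
        using \<open>e > 0\<close> pos by (auto simp: e'_def field_simps)
      have "\<forall>\<^sub>F h in at 0. norm (D 0 h) \<le> e' * \<bar>h\<bar>"
        using w(2)[of t] \<open>e' > 0\<close> unfolding has_vector_derivative_iff_eventually D_def g0 by blast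
      then show "\<forall>\<^sub>F h in at 0. norm (E 0 h) \<le> e * \<bar>h\<bar>"
      proof eventually_elim
        case (elim h)
        have "norm (E 0 h) \<le> (e' * \<bar>h\<bar>) * N * K"
          unfolding E_def using elim N \<open>K > 0\<close> \<open>e' > 0\<close>
          by (intro order_trans[OF K] mult_right_mono mult_mono) auto
        also have "\<dots> = (e' * (N * K)) * \<bar>h\<bar>" by simp
        also have "\<dots> \<le> e * \<bar>h\<bar>" using \<open>e' * (N * K) \<le> e\<close> by (intro mult_right_mono) auto
        finally show ?case .
      qed
    qed
    show ?thesis
      unfolding has_vector_derivative_iff_eventually
    proof (intro allI impI)
      fix e :: real assume "e > 0"
      define e' where "e' = e / (N * K + 1)"
      have pos: "N * K + 1 > 0" using \<open>K > 0\<close> \<open>N \<ge> 0\<close> by (simp add: add_nonneg_pos)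
      have "e' > 0" "e' * (N * K) \<le> e"
        using \<open>e > 0\<close> pos by (auto simp: e'_def field_simps)
      show "\<forall>\<^sub>F h in at 0. norm (g x (t + h) - g x t - h *\<^sub>R (g x t ** B x t)) \<le> e * \<bar>h\<bar>"
        using smallE[OF \<open>e' > 0\<close>]
      proof eventually_elim
        case (elim h)
        \<comment> \<open>Orthogonality removes the factor \<open>g^T\<close> again, so the bound on
          \<open>E\<close> becomes one on \<open>D\<close> at the cost of
          \<open>N * K\<close>.\<close>
        have "E x h ** g x (t + h) = D x h"
          using orth[of x "t + h"] unfolding E_def orthogonal_matrix_def
          by (simp add: matrix_mul_assoc[symmetric])
        then have "norm (D x h) \<le> norm (E x h) * norm (g x (t + h)) * K"
          using K[of "E x h" "g x (t + h)"] by simp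
        also have "\<dots> \<le> (e' * \<bar>h\<bar>) * N * K"
          using elim N \<open>K > 0\<close> \<open>e' > 0\<close> by (intro mult_right_mono mult_mono) auto
        also have "\<dots> = (e' * (N * K)) * \<bar>h\<bar>" by simp
        also have "\<dots> \<le> e * \<bar>h\<bar>" using \<open>e' * (N * K) \<le> e\<close> by (intro mult_right_mono) auto
        finally show ?case by (simp add: D_def)
      qed
    qed
  qed
  show ?thesis
    using g0 w(1) rot gx gt by (intro exI[of _ g]) auto
qed

text \<open>If \<open>g\<close> is of class \<open>n\<close>, then so are its partial derivatives
  \<open>g A\<close> and \<open>g B\<close>, hence \<open>g\<close> is of class
  \<open>n + 1\<close>. The induction starts because orthogonality bounds \<open>g\<close>, which
  makes both partial derivatives locally bounded.\<close>

lemma frame_smooth2: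
  fixes g A B :: "real \<Rightarrow> real \<Rightarrow> real^'n^'n"
  assumes gx: "\<And>x t. ((\<lambda>s. g s t) has_vector_derivative g x t ** A x t) (at x)"
    and gt: "\<And>x t. ((\<lambda>r. g x r) has_vector_derivative g x t ** B x t) (at t)"
    and orth: "\<And>x t. orthogonal_matrix (g x t)"
    and A: "smooth2 A" and B: "smooth2 B"
  shows "smooth2 g"
proof -
  have "C_class n (\<lambda>(x, t). g x t)" for n
  proof (induction n)
    case 0
    have "\<exists>C. \<forall>x t. \<bar>x\<bar> \<le> R \<longrightarrow> \<bar>t\<bar> \<le> R \<longrightarrow> norm (g x t ** F x t) \<le> C"
      if "smooth2 F" for R and F :: "real \<Rightarrow> real \<Rightarrow> real^'n^'n"
    proof -
      have "bounded ((\<lambda>(x, t). F x t) ` ({-R..R} \<times> {-R..R}))"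
        by (intro compact_imp_bounded compact_continuous_image compact_Times
            continuous_on_subset[OF smooth2_continuous[OF that]]) auto
      then obtain b where "\<forall>x\<in>{-R..R}. \<forall>t\<in>{-R..R}. norm (F x t) \<le> b"
        by (auto simp: bounded_iff)
      then have b: "norm (F x t) \<le> b" if "\<bar>x\<bar> \<le> R" "\<bar>t\<bar> \<le> R" for x t
        using that by (auto simp: abs_le_iff)
      obtain K where "K > 0" and K: "\<And>(P :: real^'n^'n) (Q :: real^'n^'n). norm (P ** Q) \<le> norm P * norm Q * K"
        using mm.pos_bounded by blast
      have "norm (g x t ** F x t) \<le> CARD('n) * b * K" if "\<bar>x\<bar> \<le> R" "\<bar>t\<bar> \<le> R" for x t
        using norm_orthogonal_matrix_le[OF orth] b[OF that] \<open>K > 0\<close>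
        by (intro order_trans[OF K] mult_right_mono mult_mono) auto
      then show ?thesis by blast
    qed
    from this[OF A] this[OF B]
    have "\<exists>C. \<forall>x t. \<bar>x\<bar> \<le> R \<longrightarrow> \<bar>t\<bar> \<le> R \<longrightarrow>
        norm (g x t ** A x t) \<le> C \<and> norm (g x t ** B x t) \<le> C" for R
      by (meson le_max_iff_disj)
    with continuous_on_bounded_partials[OF gx gt] show ?case by simp
  next
    case (Suc n)
    have "C_class n (\<lambda>(x, t). g x t ** F x t)" if "smooth2 F" for F :: "real \<Rightarrow> real \<Rightarrow> real^'n^'n"
      using C_class_bounded_bilinear[OF bounded_bilinear_matrix_matrix_mult Suc, of "\<lambda>(x, t). F x t"] that
      by (simp add: smooth2_def smooth_def case_prod_unfold)
    from C_class_Suc_partials[OF gx gt this[OF A] this[OF B]] show ?case .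
  qed
  then show ?thesis by (simp add: smooth2_def smooth_def)
qed

subsection \<open>Tangential and normal components\<close>

text \<open>Coordinates of a normal vector in the moving frame: \<open>g *v normal_vec v\<close> is
  the normal field with components \<open>v\<close>, while \<open>axis None 1\<close> is the
  coordinate vector of \<open>e_1\<close>.\<close>

definition normal_vec :: "real^'m \<Rightarrow> real^('m::finite option)" where
  "normal_vec v = (\<chi> a. case a of None \<Rightarrow> 0 | Some i \<Rightarrow> v $ i)"

text \<open>Naming this bilinear map lets \<open>xi_coeff\<close> be differentiated, and shown
  smooth, by the general rules for bounded bilinear maps.\<close>

definition outer_product :: "real^'m \<Rightarrow> real^'n \<Rightarrow> real^'n^'m" where
  "outer_product v w = (\<chi> i j. v $ i * w $ j)"

lemma sum_UNIV_option:
  fixes f :: "'a::finite option \<Rightarrow> 'b::comm_monoid_add"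
  shows "sum f UNIV = f None + (\<Sum>i\<in>UNIV. f (Some i))"
  by (simp add: UNIV_option_conv sum.reindex)

lemma bounded_linear_normal_vec: "bounded_linear normal_vec"
  unfolding linear_conv_bounded_linear[symmetric] linear_iff
  by (simp add: normal_vec_def vec_eq_iff split: option.split)

lemma normal_vec_zero [simp]: "normal_vec 0 = 0"
  by (rule linear_0[OF bounded_linear.linear[OF bounded_linear_normal_vec]])

lemma bounded_bilinear_outer_product: "bounded_bilinear outer_product"
  unfolding bilinear_conv_bounded_bilinear[symmetric] bilinear_def linear_iff
  by (simp add: outer_product_def vec_eq_iff algebra_simps)

lemma bounded_linear_block_matrix: "bounded_linear (\<lambda>p. block_matrix (fst p) (snd p))"
  unfolding linear_conv_bounded_linear[symmetric] linear_iff
  by (simp add: block_matrix_def vec_eq_iff split: option.split)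

lemma block_matrix_derivative:
  assumes "(v has_vector_derivative v') (at x)" and "(M has_vector_derivative M') (at x)"
  shows "((\<lambda>s. block_matrix (v s) (M s)) has_vector_derivative block_matrix v' M') (at x)"
  using bounded_linear.has_vector_derivative[OF bounded_linear_block_matrix
      has_vector_derivative_Pair[OF assms]] by simp

lemma smooth2_Pair:
  assumes "smooth2 f" and "smooth2 g"
  shows "smooth2 (\<lambda>x t. (f x t, g x t))"
proof -
  have "smooth2 (\<lambda>x t. (f x t, 0) + (0, g x t))"
    by (intro smooth2_add
        smooth2_bounded_linear[OF bounded_linear_Pair[OF bounded_linear_ident bounded_linear_zero]]
        smooth2_bounded_linear[OF bounded_linear_Pair[OF bounded_linear_zero bounded_linear_ident]]
        assms)
  then show ?thesis by simp
qed

lemma smooth2_block_matrix: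
  assumes "smooth2 v" and "smooth2 M"
  shows "smooth2 (\<lambda>x t. block_matrix (v x t) (M x t))"
  using smooth2_bounded_linear[OF bounded_linear_block_matrix smooth2_Pair[OF assms]] by simp

lemma transpose_block_matrix:
  assumes "transpose M = - M"
  shows "transpose (block_matrix v M) = - block_matrix v M"
proof -
  have "M $ i $ j + M $ j $ i = 0" for i j
    using assms by (simp add: transpose_def vec_eq_iff eq_neg_iff_add_eq_0)
  then show ?thesis
    by (simp add: transpose_def block_matrix_def vec_eq_iff eq_neg_iff_add_eq_0 split: option.split)
qed

lemma column_block_matrix: "column None (block_matrix v M) = normal_vec v"
  by (simp add: column_def block_matrix_def normal_vec_def vec_eq_iff split: option.split)

text \<open>With \<open>M = 0\<close> this is the parallel frame equation: a normal vector with
  constant coordinates has purely tangential derivative.\<close>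

lemma block_matrix_mult_normal:
  "block_matrix v M *v normal_vec w = normal_vec (M *v w) - (v \<bullet> w) *\<^sub>R axis None 1"
  by (simp add: matrix_vector_mult_def block_matrix_def normal_vec_def vec_eq_iff axis_def
      sum_UNIV_option inner_vec_def sum_negf split: option.split)

lemma mult_normal_vec:
  "G *v normal_vec v = (\<Sum>i\<in>UNIV. (v $ i) *\<^sub>R column (Some i) G)"
  by (simp add: matrix_vector_mult_def normal_vec_def vec_eq_iff sum_UNIV_option column_def mult.commute)

lemma inner_normal_vec [simp]:
  "normal_vec v \<bullet> normal_vec w = v \<bullet> w"
  "normal_vec v \<bullet> axis None 1 = 0" "axis None 1 \<bullet> normal_vec v = 0"
  by (simp_all add: inner_vec_def sum_UNIV_option normal_vec_def axis_def)

lemma orthogonal_matrix_inner: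
  fixes Q :: "real^'n^'n"
  assumes "orthogonal_matrix Q"
  shows "(Q *v a) \<bullet> (Q *v b) = a \<bullet> b"
proof -
  have "(Q *v a) \<bullet> (Q *v b) = (transpose Q *v (Q *v a)) \<bullet> b"
    by (simp add: dot_lmul_matrix)
  then show ?thesis
    using assms by (simp add: matrix_vector_mul_assoc orthogonal_matrix_def)
qed

lemma orthogonal_matrix_norm:
  fixes Q :: "real^'n^'n"
  shows "orthogonal_matrix Q \<Longrightarrow> norm (Q *v a) = norm a"
  by (simp add: norm_eq_sqrt_inner orthogonal_matrix_inner)

lemma transpose_mult_nth: "(transpose P ** Q) $ a $ b = column a P \<bullet> column b Q"
  by (simp add: matrix_matrix_mult_def transpose_def column_def inner_vec_def)

lemma column_derivative:
  fixes g :: "real \<Rightarrow> real^'n^'m"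
  shows "(g has_vector_derivative g') (at x) \<Longrightarrow>
   ((\<lambda>s. column a (g s)) has_vector_derivative column a g') (at x)"
  using mv_derivative[OF _ has_vector_derivative_const[of "axis a 1"], of g g' x UNIV]
  by (simp add: matrix_vector_mult_basis)

lemma lborel_integral_derivative:
  fixes f :: "real \<Rightarrow> 'a::euclidean_space"
  assumes "continuous_on UNIV f"
  shows "((\<lambda>u. LBINT y=0..u. f y) has_vector_derivative f x) (at x)"
proof -
  \<comment> \<open>An interval with both 0 and \<open>x\<close> in its interior, whatever the sign
    of \<open>x\<close>, so that the one-sided derivative is the full one.\<close>
  let ?a = "- \<bar>x\<bar> - 1" and ?b = "\<bar>x\<bar> + 1"
  have "((\<lambda>u. LBINT y=ereal 0..u. f y) has_vector_derivative f x) (at x within {?a..?b})"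
    by (rule interval_integral_FTC2) (auto intro: continuous_on_subset[OF assms])
  moreover have "at x within {?a..?b} = at x"
    by (rule at_within_interior) auto
  ultimately show ?thesis
    unfolding zero_ereal_def by (simp only:)
qed

text \<open>Replaces \<open>matrix_inv\<close> and the derivative operators by the equations
  \<open>g_x = g A\<close> and \<open>g_t = g B\<close>, to which the results on differential
  equations apply.\<close>

lemma airy_frame_iff:
  "airy_frame k G g \<longleftrightarrow>
     (\<forall>x t. rotation_matrix (g x t)) \<and>
     (\<forall>x t. ((\<lambda>s. g s t) has_vector_derivative g x t ** block_matrix (k x t) 0) (at x)) \<and>
     (\<forall>x t. ((\<lambda>r. g x r) has_vector_derivative
        g x t ** block_matrix (z_coeff k x t) (xi_coeff k x t)) (at t)) \<and>
     g 0 0 = G" (is "_ \<longleftrightarrow> ?R")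
proof
  assume L: "airy_frame k G g"
  then have "orthogonal_matrix (g x t)" for x t
    by (simp add: airy_frame_def rotation_matrix_def)
  then have "partial_x g x t = g x t ** block_matrix (k x t) 0"
    "partial_t g x t = g x t ** block_matrix (z_coeff k x t) (xi_coeff k x t)" for x t
    using L by (simp_all add: airy_frame_def orthogonal_matrix_inv_mult_eq_iff)
  then show ?R
    using L by (auto simp: airy_frame_def partial_x_def partial_t_def vector_derivative_works)
next
  assume R: ?R
  then have "orthogonal_matrix (g x t)" for x t
    by (simp add: rotation_matrix_def)
  moreover have "partial_x g x t = g x t ** block_matrix (k x t) 0"
    "partial_t g x t = g x t ** block_matrix (z_coeff k x t) (xi_coeff k x t)" for x t
    using R by (auto simp: partial_x_def partial_t_def intro!: vector_derivative_at)
  moreover have "(\<lambda>s. g s t) differentiable (at x)" "g x differentiable (at t)" for x t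
    using R differentiableI_vector by blast+
  ultimately show "airy_frame k G g"
    using R by (simp add: airy_frame_def orthogonal_matrix_inv_mult_eq_iff)
qed

text \<open>Differentiating \<open>g^T g = 1\<close> shows that \<open>W = g^T g'\<close> is skew.
  Its first column consists of the principal curvatures, and its lower right block vanishes because
  parallel normal fields have derivatives along \<open>e_1\<close>. The given frame thus satisfies
  the same x-equation as an Airy frame at \<open>t = 0\<close>.\<close>

lemma parallel_frame_derivative:
  fixes c :: "real \<Rightarrow> real^('m::finite option)"
  assumes "arclength_parametrized c" and "parallel_frame c g"
  shows "(g has_vector_derivative g x ** block_matrix (principal_curvatures g x) 0) (at x)"
proof -
  define g' where "g' x = vector_derivative g (at x)" for x
  define W where "W = transpose (g x) ** g' x"
  have dg: "(g has_vector_derivative g' x) (at x)" for x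
    unfolding g'_def using assms(2) by (intro smooth_has_vector_derivative) (simp add: parallel_frame_def)
  have orth: "orthogonal_matrix (g x)" for x
    using assms(2) by (simp add: parallel_frame_def rotation_matrix_def)
  have dcol: "vector_derivative (\<lambda>s. column a (g s)) (at x) = column a (g' x)" for a x
    by (rule vector_derivative_at[OF column_derivative[OF dg]])
  have c': "vector_derivative c (at x) = column None (g x)"
    and nc: "normal_connection c (\<lambda>s. column (Some i) (g s)) x = 0" for i
    using assms(2) by (auto simp: parallel_frame_def)
  have one: "norm (column None (g x)) = 1"
    using assms(1) by (metis arclength_parametrized_def c')
  have "(\<lambda>s. transpose (g s) ** g s) = (\<lambda>s. mat 1)"
    using orth by (auto simp: orthogonal_matrix_def)
  then have "((\<lambda>s. mat 1) has_vector_derivative transpose (g x) ** g' x + transpose (g' x) ** g x) (at x)"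
    using mm_derivative[OF transpose_derivative[OF dg] dg, of x] by simp
  then have "W + transpose W = 0"
    unfolding W_def
    by (metis has_vector_derivative_const matrix_transpose_mul transpose_transpose vector_derivative_at)
  then have skew: "W $ b $ a = - W $ a $ b" for a b
    by (simp add: vec_eq_iff transpose_def eq_neg_iff_add_eq_0)
  have k: "W $ Some i $ None = principal_curvatures g x $ i" for i
    by (simp add: W_def transpose_mult_nth principal_curvatures_def dcol inner_commute)
  have "W $ Some i $ Some j = 0" for i j
  proof -
    have "column (Some j) (g' x) = (column (Some j) (g' x) \<bullet> column None (g x)) *\<^sub>R column None (g x)"
      using nc[of j] by (simp add: normal_connection_def arc_derivative_def unit_tangent_def c' dcol one)
    moreover have "column (Some i) (g x) \<bullet> column None (g x) = 0"
      using orth[of x] by (simp add: orthogonal_matrix_orthonormal_columns orthogonal_def)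
    ultimately show ?thesis
      unfolding W_def transpose_mult_nth by (metis inner_scaleR_right mult_zero_right)
  qed
  moreover have "W $ None $ None = 0" "W $ None $ Some j = - principal_curvatures g x $ j" for j
    using skew[of None None] skew[of "Some j" None] k[of j] by auto
  ultimately have "W = block_matrix (principal_curvatures g x) 0"
    by (auto simp: vec_eq_iff block_matrix_def k split: option.split)
  moreover have "g x ** W = g' x"
    using orth[of x] by (simp add: W_def matrix_mul_assoc orthogonal_matrix_def)
  ultimately show ?thesis using dg[of x] by simp
qed

subsection \<open>The vmKdV flow\<close>

locale vmKdV =
  fixes k :: "real \<Rightarrow> real \<Rightarrow> real^'m::finite"
  assumes solution: "vmKdV_solution k"
begin

abbreviation kx where "kx \<equiv> partial_x k"
abbreviation kxx where "kxx \<equiv> partial_x kx"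
abbreviation kxxx where "kxxx \<equiv> partial_x kxx"
abbreviation A where "A x t \<equiv> block_matrix (k x t) 0"
abbreviation B where "B x t \<equiv> block_matrix (z_coeff k x t) (xi_coeff k x t)"

lemma smooth_k: "smooth2 k" "smooth2 kx" "smooth2 kxx"
  using solution by (auto simp: vmKdV_solution_def intro: smooth2_partials)

lemmas k_derivatives = smooth_k[THEN smooth2_partials(1)]

lemma k_t: "partial_t k x t = - (kxxx x t + (3 / 2 * (k x t \<bullet> k x t)) *\<^sub>R kx x t)"
  using solution by (simp add: vmKdV_solution_def power2_norm_eq_inner)

lemma z_coeff_eq: "z_coeff k x t = - (kxx x t + (1 / 2) *\<^sub>R ((k x t \<bullet> k x t) *\<^sub>R k x t))"
  by (simp add: z_coeff_def power2_norm_eq_inner)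

lemma xi_coeff_eq: "xi_coeff k x t = outer_product (kx x t) (k x t) - outer_product (k x t) (kx x t)"
  by (simp add: xi_coeff_def outer_product_def vec_eq_iff)

lemma smooth_coeffs: "smooth2 (z_coeff k)" "smooth2 (xi_coeff k)"
  unfolding z_coeff_eq[abs_def] xi_coeff_eq[abs_def]
  by (intro smooth2_minus smooth2_add smooth2_diff smooth_k
      smooth2_bounded_bilinear[OF bounded_bilinear_scaleR] smooth2_const
      smooth2_bounded_bilinear[OF bounded_bilinear_inner]
      smooth2_bounded_bilinear[OF bounded_bilinear_outer_product])+

lemma smooth_AB: "smooth2 (\<lambda>x t. A x t)" "smooth2 (\<lambda>x t. B x t)"
  by (intro smooth2_block_matrix smooth_k smooth_coeffs smooth2_const)+

lemma skew_AB: "transpose (A x t) = - A x t" "transpose (B x t) = - B x t"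
  by (rule transpose_block_matrix;
      simp add: transpose_def xi_coeff_def vec_eq_iff)+

section \<open>The zero curvature identity\<close>

definition z_x where
  "z_x x t = - (kxxx x t + (k x t \<bullet> kx x t) *\<^sub>R k x t + (1 / 2 * (k x t \<bullet> k x t)) *\<^sub>R kx x t)"

text \<open>The two products of \<open>kx\<close> with itself arising from the product rule
  cancel.\<close>

definition xi_x where
  "xi_x x t = outer_product (kxx x t) (k x t) - outer_product (k x t) (kxx x t)"

lemma z_derivative: "((\<lambda>s. z_coeff k s t) has_vector_derivative z_x x t) (at x)"
proof -
  have "((\<lambda>s. z_coeff k s t) has_vector_derivative
      - (kxxx x t + (1 / 2) *\<^sub>R ((k x t \<bullet> k x t) *\<^sub>R kx x t
          + (k x t \<bullet> kx x t + kx x t \<bullet> k x t) *\<^sub>R k x t))) (at x)"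
    unfolding z_coeff_eq
    by (intro has_vector_derivative_minus has_vector_derivative_add k_derivatives
        bounded_linear.has_vector_derivative[OF bounded_linear_scaleR_right]
        bounded_bilinear.has_vector_derivative[OF bounded_bilinear_scaleR]
        bounded_bilinear.has_vector_derivative[OF bounded_bilinear_inner])
  then show ?thesis
    by (simp add: z_x_def inner_commute scaleR_add_left scaleR_add_right algebra_simps)
qed

lemma xi_derivative: "((\<lambda>s. xi_coeff k s t) has_vector_derivative xi_x x t) (at x)"
proof -
  have "((\<lambda>s. xi_coeff k s t) has_vector_derivative
      (outer_product (kx x t) (kx x t) + outer_product (kxx x t) (k x t))
      - (outer_product (k x t) (kxx x t) + outer_product (kx x t) (kx x t))) (at x)"
    unfolding xi_coeff_eq
    by (intro has_vector_derivative_diff k_derivatives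
        bounded_bilinear.has_vector_derivative[OF bounded_bilinear_outer_product])
  then show ?thesis by (simp add: xi_x_def)
qed

lemma xi_mult_k: "(\<Sum>l\<in>UNIV. xi_coeff k x t $ i $ l * k x t $ l)
    = (k x t \<bullet> k x t) * kx x t $ i - (k x t \<bullet> kx x t) * k x t $ i"
  by (simp add: xi_coeff_def inner_vec_def sum_subtractf sum_distrib_left sum_distrib_right algebra_simps)

lemma k_mult_xi: "(\<Sum>l\<in>UNIV. k x t $ l * xi_coeff k x t $ l $ i)
    = (k x t \<bullet> kx x t) * k x t $ i - (k x t \<bullet> k x t) * kx x t $ i"
  by (simp add: xi_coeff_def inner_vec_def sum_subtractf sum_distrib_left sum_distrib_right algebra_simps)

text \<open>The lower left block reads \<open>k_t + xi k = z_x\<close>, which is the vmKdV equation,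
  and the upper right block is its negative transpose. The lower right block reads
  \<open>xi_x = k z^T - z k^T\<close>, where the cubic terms of \<open>z\<close> cancel.\<close>

lemma zero_curvature:
  "block_matrix (partial_t k x t) 0 + B x t ** A x t = block_matrix (z_x x t) (xi_x x t) + A x t ** B x t"
proof -
  have "(block_matrix (partial_t k x t) 0 + B x t ** A x t) $ a $ b
      = (block_matrix (z_x x t) (xi_x x t) + A x t ** B x t) $ a $ b" for a b
    by (cases a; cases b)
      (simp_all add: matrix_matrix_mult_def block_matrix_def sum_UNIV_option xi_mult_k k_mult_xi
        k_t z_x_def z_coeff_eq xi_x_def outer_product_def sum_negf,
        simp_all add: sum.distrib sum_subtractf sum_negf algebra_simps)
  then show ?thesis by (simp add: vec_eq_iff)
qed

section \<open>Existence and uniqueness of the frame\<close>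

lemma airy_frame_exists:
  assumes "rotation_matrix G"
  shows "\<exists>g. airy_frame k G g"
proof -
  have "\<exists>g. g 0 0 = G \<and> (\<forall>x t. rotation_matrix (g x t)) \<and>
    (\<forall>x t. ((\<lambda>s. g s t) has_vector_derivative g x t ** A x t) (at x)) \<and>
    (\<forall>x t. ((\<lambda>r. g x r) has_vector_derivative g x t ** B x t) (at t))"
  proof (rule flat_frame_exists[OF skew_AB smooth_AB[THEN smooth2_continuous] _ _ _ zero_curvature assms])
    show "((\<lambda>r. A x r) has_vector_derivative block_matrix (partial_t k x t) 0) (at t)" for x t
      by (intro block_matrix_derivative smooth2_partials smooth_k has_vector_derivative_const)
    show "continuous_on UNIV (\<lambda>(x, t). block_matrix (partial_t k x t) 0)"
      by (intro smooth2_continuous smooth2_block_matrix smooth2_partials smooth_k smooth2_const)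
    show "((\<lambda>s. B s t) has_vector_derivative block_matrix (z_x x t) (xi_x x t)) (at x)" for x t
      by (intro block_matrix_derivative z_derivative xi_derivative)
  qed
  then show ?thesis by (auto simp: airy_frame_iff)
qed

text \<open>Uniqueness follows the order of the construction: first the t-equation on the t-axis,
  then the x-equation along each horizontal line.\<close>

lemma airy_frame_unique:
  assumes "airy_frame k G g" and "airy_frame k G h"
  shows "g = h"
proof -
  have orth: "orthogonal_matrix (h x t)" for x t
    using assms(2) by (simp add: airy_frame_iff rotation_matrix_def)
  have g0: "g 0 t = h 0 t" for t
    by (rule skew_ode_unique[where u = "g 0" and v = "h 0", OF _ skew_AB(2) _ _ orth])
      (use assms in \<open>auto simp: airy_frame_iff\<close>)
  have "g x t = h x t" for x t
    by (rule skew_ode_unique[where u = "\<lambda>s. g s t" and v = "\<lambda>s. h s t" and t = x, OF _ skew_AB(1) _ _ orth])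
      (use assms g0 in \<open>auto simp: airy_frame_iff\<close>)
  then show ?thesis by blast
qed

section \<open>The reconstructed curve and its evolution\<close>

context
  fixes G g
  assumes frame: "airy_frame k G g"
begin

lemma orth: "orthogonal_matrix (g x t)"
  and g_x: "((\<lambda>s. g s t) has_vector_derivative g x t ** A x t) (at x)"
  and g_t: "((\<lambda>r. g x r) has_vector_derivative g x t ** B x t) (at t)"
  using frame by (auto simp: airy_frame_iff rotation_matrix_def)

lemma smooth_g: "smooth2 g"
  by (rule frame_smooth2[OF g_x g_t orth smooth_AB])

text \<open>Differentiation in frame coordinates: a field with coordinates \<open>w\<close> has
  derivative with coordinates \<open>w' + A w\<close>.\<close>

lemma frame_field_x:
  assumes "((\<lambda>s. w s) has_vector_derivative w') (at x)"
  shows "((\<lambda>s. g s t *v w s) has_vector_derivative g x t *v (w' + A x t *v w x)) (at x)"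
  using mv_derivative[OF g_x assms] by (simp add: mv.add_right matrix_vector_mul_assoc)

lemma e1_x: "((\<lambda>s. column None (g s t)) has_vector_derivative g x t *v normal_vec (k x t)) (at x)"
  using frame_field_x[OF has_vector_derivative_const[of "axis None 1"]]
  by (simp add: matrix_vector_mult_basis column_block_matrix)

lemma e1_t: "((\<lambda>r. column None (g x r)) has_vector_derivative g x t *v normal_vec (z_coeff k x t)) (at t)"
  using column_derivative[OF g_t, of None x t]
  by (metis column_block_matrix matrix_vector_mul_assoc matrix_vector_mult_basis)

lemma Z_field_eq:
  "Z_field k g x t = g x t *v (- ((1 / 2 * (k x t \<bullet> k x t)) *\<^sub>R axis None 1 + normal_vec (kx x t)))"
  by (simp add: Z_field_def mv.minus_right mv.add_right mv.diff_right mv.scaleR_right matrix_vector_mult_basis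
      mult_normal_vec power2_norm_eq_inner)

text \<open>This is the compatibility \<open>Z_x = (e_1)_t\<close>. The tangential term from
  differentiating half of the squared norm of \<open>k\<close> cancels against the one that
  \<open>A\<close> produces from the normal part of \<open>Z\<close>, and the rest is the normal
  field with components \<open>z\<close>.\<close>

lemma Z_x: "((\<lambda>s. Z_field k g s t) has_vector_derivative g x t *v normal_vec (z_coeff k x t)) (at x)"
proof -
  let ?w = "\<lambda>s. - ((1 / 2 * (k s t \<bullet> k s t)) *\<^sub>R axis None 1 + normal_vec (kx s t)) :: real^'m option"
  have "(?w has_vector_derivative - ((1 / 2 * (k x t \<bullet> kx x t + kx x t \<bullet> k x t)) *\<^sub>R axis None 1
      + normal_vec (kxx x t))) (at x)"
    by (intro has_vector_derivative_minus has_vector_derivative_add k_derivatives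
        bounded_linear.has_vector_derivative[OF bounded_linear_scaleR_left]
        bounded_linear.has_vector_derivative[OF bounded_linear_mult_right]
        bounded_linear.has_vector_derivative[OF bounded_linear_normal_vec]
        bounded_bilinear.has_vector_derivative[OF bounded_bilinear_inner])
  from frame_field_x[OF this]
  have "((\<lambda>s. Z_field k g s t) has_vector_derivative g x t *v
      (- ((k x t \<bullet> kx x t) *\<^sub>R axis None 1 + normal_vec (kxx x t)) + A x t *v ?w x)) (at x)"
    by (simp add: Z_field_eq inner_commute)
  moreover have "- ((k x t \<bullet> kx x t) *\<^sub>R axis None 1 + normal_vec (kxx x t)) + A x t *v ?w x
      = normal_vec (z_coeff k x t)"
    by (simp add: mv.minus_right mv.add_right mv.diff_right mv.scaleR_right matrix_vector_mult_basis column_block_matrix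
        block_matrix_mult_normal z_coeff_eq)
      (simp add: normal_vec_def vec_eq_iff axis_def split: option.split)
  ultimately show ?thesis by simp
qed

lemma smooth_fields:
  "smooth2 (\<lambda>x t. column None (g x t))" "smooth2 (Z_field k g)"
  "smooth2 (\<lambda>x t. g x t *v normal_vec (z_coeff k x t))"
  unfolding Z_field_eq[abs_def] matrix_vector_mult_basis[symmetric]
  by (intro smooth2_bounded_bilinear[OF bounded_bilinear_matrix_vector_mult] smooth_g smooth2_minus
      smooth2_add smooth2_bounded_bilinear[OF bounded_bilinear_scaleR] smooth2_const smooth_k
      smooth_coeffs smooth2_bounded_linear[OF bounded_linear_normal_vec]
      smooth2_bounded_bilinear[OF bounded_bilinear_mult]
      smooth2_bounded_bilinear[OF bounded_bilinear_inner])+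

text \<open>At \<open>x = 0\<close> the integral of \<open>e_1\<close> vanishes, so the t-derivative
  is \<open>Z\<close> by the fundamental theorem of calculus; \<open>Z_x = (e_1)_t\<close> carries
  this to every \<open>x\<close>.\<close>

lemma
  fixes p
  defines "\<gamma> \<equiv> reconstructed_curve p k g"
  shows reconstructed_curve_x: "((\<lambda>s. \<gamma> s t) has_vector_derivative column None (g x t)) (at x)"
    and reconstructed_curve_t: "((\<lambda>r. \<gamma> x r) has_vector_derivative Z_field k g x t) (at t)"
proof -
  have slice: "continuous_on UNIV (\<lambda>s. f s t)" "continuous_on UNIV (\<lambda>r. f x r)"
    if "smooth2 f" for f :: "real \<Rightarrow> real \<Rightarrow> real^'m option" and x t
    using smooth2_partials(1,2)[OF that]
    by (auto intro!: continuous_at_imp_continuous_on has_vector_derivative_continuous)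
  have *: "((\<lambda>s. \<gamma> s t) has_vector_derivative column None (g x t)) (at x)" for x t
    using has_vector_derivative_add[OF has_vector_derivative_const
        lborel_integral_derivative[OF slice(1)[OF smooth_fields(1)]]]
    unfolding \<gamma>_def reconstructed_curve_def by simp
  then show "((\<lambda>s. \<gamma> s t) has_vector_derivative column None (g x t)) (at x)" .
  have "((\<lambda>r. \<gamma> 0 r) has_vector_derivative Z_field k g 0 t) (at t)"
    using has_vector_derivative_add[OF has_vector_derivative_const
        lborel_integral_derivative[OF slice(2)[OF smooth_fields(2)]]]
    unfolding \<gamma>_def reconstructed_curve_def by (simp add: interval_integral_endpoints_same flip: zero_ereal_def)
  with * e1_t smooth2_continuous[OF smooth_fields(3)] Z_x
  show "((\<lambda>r. \<gamma> x r) has_vector_derivative Z_field k g x t) (at t)"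
    by (rule has_vector_derivative_partial_t_transfer)
qed

text \<open>Since \<open>e_1\<close> is a unit vector, every curve of the family is parametrized by
  arc length and has \<open>H = g *v normal_vec k\<close>. Projecting its derivative to the normal
  space removes the multiple of \<open>e_1\<close>, so the right-hand side of the flow equation is
  exactly \<open>Z\<close>.\<close>

lemma reconstructed_curve_flow: "geometric_airy_flow (reconstructed_curve p k g)"
proof -
  let ?\<gamma> = "reconstructed_curve p k g"
  have \<gamma>_x: "vector_derivative (\<lambda>s. ?\<gamma> s t) (at x) = column None (g x t)" for x t
    by (rule vector_derivative_at[OF reconstructed_curve_x])
  have one: "norm (column None (g x t)) = 1" for x t
    using orth[of x t] by (simp add: orthogonal_matrix_orthonormal_columns)
  have T: "unit_tangent (\<lambda>s. ?\<gamma> s t) = (\<lambda>x. column None (g x t))" for t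
    by (rule ext) (simp add: unit_tangent_def \<gamma>_x one)
  have H: "curvature_vector (\<lambda>s. ?\<gamma> s t) = (\<lambda>x. g x t *v normal_vec (k x t))" for t
    by (rule ext) (simp add: curvature_vector_def arc_derivative_def T \<gamma>_x one
        vector_derivative_at[OF e1_x])
  have dH: "arc_derivative (\<lambda>s. ?\<gamma> s t) (\<lambda>x. g x t *v normal_vec (k x t)) x
      = g x t *v (normal_vec (kx x t) - (k x t \<bullet> k x t) *\<^sub>R axis None 1)" for x t
  proof -
    have "((\<lambda>s. g s t *v normal_vec (k s t)) has_vector_derivative
        g x t *v (normal_vec (kx x t) + A x t *v normal_vec (k x t))) (at x)"
      by (intro frame_field_x bounded_linear.has_vector_derivative[OF bounded_linear_normal_vec]
          k_derivatives)
    from vector_derivative_at[OF this] show ?thesis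
      by (simp add: arc_derivative_def \<gamma>_x one block_matrix_mult_normal)
  qed
  have norm_H: "norm (g x t *v normal_vec (k x t)) = norm (k x t)" for x t
    unfolding orthogonal_matrix_norm[OF orth] by (simp add: norm_eq_sqrt_inner)
  have "normal_connection (\<lambda>s. ?\<gamma> s t) (\<lambda>x. g x t *v normal_vec (k x t)) x
      = g x t *v normal_vec (kx x t)" for x t
    unfolding normal_connection_def dH T matrix_vector_mult_basis[symmetric] orthogonal_matrix_inner[OF orth]
    by (simp add: inner_diff_left mv.diff_right mv.scaleR_right inner_axis_axis)
  then have "Z_field k g x t = - (((norm (curvature_vector (\<lambda>s. ?\<gamma> s t) x))\<^sup>2 / 2) *\<^sub>R
      unit_tangent (\<lambda>s. ?\<gamma> s t) x + normal_connection (\<lambda>s. ?\<gamma> s t) (curvature_vector (\<lambda>s. ?\<gamma> s t)) x)" for x t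
    by (simp add: H T Z_field_def norm_H flip: mult_normal_vec)
  moreover have "partial_t ?\<gamma> x t = Z_field k g x t" for x t
    unfolding partial_t_def by (rule vector_derivative_at[OF reconstructed_curve_t])
  moreover have "partial_x ?\<gamma> x t \<noteq> 0" for x t
    unfolding partial_x_def \<gamma>_x using one[of x t] by force
  moreover have "smooth2 ?\<gamma>"
    by (rule smooth2_of_partials[OF reconstructed_curve_x reconstructed_curve_t smooth_fields(1,2)])
  ultimately show ?thesis
    by (simp add: geometric_airy_flow_def Let_def)
qed

end

end

theorem theorem2p7:
  fixes \<gamma>\<^sub>0 :: "real \<Rightarrow> real^('m::finite option)"
    and g\<^sub>0 :: "real \<Rightarrow> real^('m option)^('m option)"
    and k :: "real \<Rightarrow> real \<Rightarrow> real^'m"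
  assumes "smooth \<gamma>\<^sub>0" and "arclength_parametrized \<gamma>\<^sub>0"
    and "parallel_frame \<gamma>\<^sub>0 g\<^sub>0"
    and "vmKdV_solution k"
    and "\<forall>x. k x 0 = principal_curvatures g\<^sub>0 x"
  shows "(\<exists>!g. airy_frame k (g\<^sub>0 0) g) \<and>
    (\<forall>g. airy_frame k (g\<^sub>0 0) g \<longrightarrow>
       smooth2 g \<and>
       geometric_airy_flow (reconstructed_curve (\<gamma>\<^sub>0 0) k g) \<and>
       (\<forall>x. reconstructed_curve (\<gamma>\<^sub>0 0) k g x 0 = \<gamma>\<^sub>0 x))"
proof -
  interpret vmKdV k by unfold_locales fact
  have rot: "rotation_matrix (g\<^sub>0 x)" and tangent: "vector_derivative \<gamma>\<^sub>0 (at x) = column None (g\<^sub>0 x)" for x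
    using assms(3) by (auto simp: parallel_frame_def)
  have "reconstructed_curve (\<gamma>\<^sub>0 0) k g x 0 = \<gamma>\<^sub>0 x" if frame: "airy_frame k (g\<^sub>0 0) g" for g x
  proof -
    let ?\<gamma> = "reconstructed_curve (\<gamma>\<^sub>0 0) k g"
    \<comment> \<open>At \<open>t = 0\<close> both frames solve the same x-equation with the same
      value at 0, hence agree; the two curves then have equal tangents and differ by a
      constant.\<close>
    have "g x 0 = g\<^sub>0 x" for x
      by (rule skew_ode_unique[where u = "\<lambda>s. g s 0", OF g_x[OF frame] skew_AB(1)])
        (use parallel_frame_derivative[OF assms(2,3)] frame rot in \<open>auto simp: assms(5) airy_frame_iff rotation_matrix_def\<close>)
    then have "((\<lambda>s. ?\<gamma> s 0 - \<gamma>\<^sub>0 s) has_vector_derivative 0) (at x)" for x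
      using has_vector_derivative_diff[OF reconstructed_curve_x[OF frame]
          smooth_has_vector_derivative[OF assms(1)], of "\<gamma>\<^sub>0 0" 0 x] by (simp add: tangent)
    then have "?\<gamma> x 0 - \<gamma>\<^sub>0 x = ?\<gamma> 0 0 - \<gamma>\<^sub>0 0"
      by (rule zero_vector_derivative_constant)
    moreover have "?\<gamma> 0 0 = \<gamma>\<^sub>0 0"
      by (simp add: reconstructed_curve_def interval_integral_endpoints_same flip: zero_ereal_def)
    ultimately show ?thesis by simp
  qed
  then show ?thesis
    using airy_frame_exists[OF rot] airy_frame_unique smooth_g reconstructed_curve_flow by blast
qed

end
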